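(* Let $f:\mathbb{R}^m\times\mathbb{R}^n\to\mathbb{R}$ be $\ell$-smooth, with $f(\cdot,\mathbf{y})$ $L$-Lipschitz for each $\mathbf{y}\in\mathcal{Y}$ and $f(\mathbf{x},\cdot)$ concave for each $\mathbf{x}\in\mathbb{R}^m$, where $\mathcal{Y}\subset\mathbb{R}^n$ is a convex and bounded set with diameter $D\ge 0$. Let $G=(G_{\mathbf{x}},G_{\mathbf{y}})$ be a stochastic gradient oracle for $f$ that is unbiased with variance bounded by $\sigma^2$. Put $\Phi(\mathbf{x})=\max_{\mathbf{y}\in\mathcal{Y}}f(\mathbf{x},\mathbf{y})$, $\widehat{\Delta}_\Phi=\Phi_{1/2\ell}(\mathbf{x}_0)-\min_{\mathbf{x}}\Phi_{1/2\ell}(\mathbf{x})$ and $\widehat{\Delta}_0=\Phi(\mathbf{x}_0)-f(\mathbf{x}_0,\mathbf{y}_0)$. Let the step sizes of two-timescale SGDA be chosen as $$\eta_{\mathbf{x}}=\Theta\!\left(\frac{\epsilon^4}{\ell^3D^2(L^2+\sigma^2)}\right),\qquad \eta_{\mathbf{y}}=\Theta\!\left(\frac{\epsilon^2}{\ell\sigma^2}\right),$$ with batch size $M=1$. Then the iteration complexity (also the stochastic gradient complexity) of two-timescale SGDA to return an $\epsilon$-stationary point of $\Phi$ is bounded by $$O\left(\left(\frac{\ell^3(L^2+\sigma^2)D^2\widehat{\Delta}_\Phi}{\epsilon^6}+\frac{\ell^3D^2\widehat{\Delta}_0}{\epsilon^4}\right)\max\left\{1,\ \frac{\sigma^2}{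\epsilon^2}\right\}\right).$$
   Context: A function $g$ is $\ell$-smooth if $\|\nabla g(\mathbf{z})-\nabla g(\mathbf{z}')\|\le\ell\|\mathbf{z}-\mathbf{z}'\|$ for all $\mathbf{z},\mathbf{z}'$ (for $f$: jointly in $(\mathbf{x},\mathbf{y})$), and $L$-Lipschitz if $|g(\mathbf{z})-g(\mathbf{z}')|\le L\|\mathbf{z}-\mathbf{z}'\|$. Norms are Euclidean; $\mathcal{P}_{\mathcal{Y}}$ is Euclidean projection onto $\mathcal{Y}$. The set $\mathcal{Y}$ is understood to be nonempty and closed, so that the maximum and the projection exist, and $\Phi$ is understood to be bounded below. Under these assumptions $\Phi$ is $\ell$-weakly convex, i.e. $\Phi(\cdot)+(\ell/2)\|\cdot\|^2$ is convex. The Moreau envelope $\Phi_{1/2\ell}(\mathbf{x})=\min_{\mathbf{w}}\{\Phi(\mathbf{w})+\ell\|\mathbf{w}-\mathbf{x}\|^2\}$ is differentiable. A point $\mathbf{x}$ is an $\epsilon$-stationary point of $\Phi$ if $\|\nabla\Phi_{1/2\ell}(\mathbf{x})\|\le\epsilon$. Stochastic oracle: $\mathbb{E}[G(\mathbf{x},\mathbf{y},\xi)-\nabla f(\mathbf{x},\mathbf{y})]=0$ and $\mathbb{E}[\|G(\mathbf{x},\mathbf{y},\xi)-\nabla f(\mathbf{x},\mathbf{y})\|^2]\le\sigma^2$. Two-timescale SGDA with batch size $M$: given $(\mathbf{x}_0,\mathbf{y}_0)$ with $\mathbf{y}_0\in\mathcal{Y}$ and stepsizes $(\eta_{\mathbf{x}},\eta_{\mathbf{y}})$,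 for $t=1,\dots,T$ draw i.i.d. samples $\xi_1,\dots,\xi_M$ and set $$\mathbf{x}_t=\mathbf{x}_{t-1}-\eta_{\mathbf{x}}\Big(\tfrac1M\sum_{i=1}^MG_{\mathbf{x}}(\mathbf{x}_{t-1},\mathbf{y}_{t-1},\xi_i)\Big),\qquad \mathbf{y}_t=\mathcal{P}_{\mathcal{Y}}\Big(\mathbf{y}_{t-1}+\eta_{\mathbf{y}}\Big(\tfrac1M\sum_{i=1}^MG_{\mathbf{y}}(\mathbf{x}_{t-1},\mathbf{y}_{t-1},\xi_i)\Big)\Big);$$ return $\hat{\mathbf{x}}$ drawn uniformly at random from $\{\mathbf{x}_t\}_{t=1}^T$. Returning an $\epsilon$-stationary point is understood for this random output, i.e. $\mathbb{E}\|\nabla\Phi_{1/2\ell}(\hat{\mathbf{x}})\|^2\le\epsilon^2$. The symbols $\Theta(\cdot)$ and $O(\cdot)$ hide absolute constants.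
   Formalization: The claim is proved for ε ≤ κσ and ε ≤ κℓD (so σ, D > 0) with any κ ≥ 1; the constants hidden in Θ and O depend on κ only. Constants uniform in ε/σ and ε/(ℓD) do not exist, and for σ = 0 or D = 0 the step sizes are undefined. *)

theory Defs
  imports "HOL-Probability.Probability"
begin

definition grad :: "('a::real_inner \<Rightarrow> real) \<Rightarrow> 'a \<Rightarrow> 'a" where
  "grad g z = (THE D. GDERIV g z :> D)"

definition smooth_fun :: "real \<Rightarrow> ('a::real_inner \<Rightarrow> real) \<Rightarrow> bool" where
  "smooth_fun l g \<longleftrightarrow>
     (\<forall>z. \<exists>D. GDERIV g z :> D) \<and> (\<forall>z z'. norm (grad g z - grad g z') \<le> l * norm (z - z'))"

(* For f continuous and Y nonempty and compact the supremum is attained,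
   so this is the maximum over Y. *)
definition max_fun :: "('a \<times> 'b \<Rightarrow> real) \<Rightarrow> 'b set \<Rightarrow> 'a \<Rightarrow> real" where
  "max_fun f Y x = (SUP y\<in>Y. f (x, y))"

(* With lam = 1 / (2 * l) the penalty is l * norm (w - x)^2. *)
definition moreau_envelope :: "real \<Rightarrow> ('a::real_normed_vector \<Rightarrow> real) \<Rightarrow> 'a \<Rightarrow> real" where
  "moreau_envelope lam g x = (INF w. g w + (norm (w - x))\<^sup>2 / (2 * lam))"

(* P is the law of a single sample. Since z ranges over the product space, norm is the
   Euclidean norm of the pair and sigma^2 bounds the variance of both blocks together. *)
definition stochastic_gradient_oracle ::
  "('z::euclidean_space \<Rightarrow> real) \<Rightarrow> 's measure \<Rightarrow> ('z \<Rightarrow> 's \<Rightarrow> 'z) \<Rightarrow> real \<Rightarrow> bool" where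
  "stochastic_gradient_oracle f P G \<sigma> \<longleftrightarrow>
     prob_space P \<and>
     (\<lambda>(z, s). G z s) \<in> borel_measurable (borel \<Otimes>\<^sub>M P) \<and>
     (\<forall>z. integrable P (\<lambda>s. G z s - grad f z) \<and>
          (\<integral>s. (G z s - grad f z) \<partial>P) = 0 \<and>
          integrable P (\<lambda>s. (norm (G z s - grad f z))\<^sup>2) \<and>
          (\<integral>s. (norm (G z s - grad f z))\<^sup>2 \<partial>P) \<le> \<sigma>\<^sup>2)"

definition sample_indices :: "nat \<Rightarrow> (nat \<times> nat) set" where
  "sample_indices B = {1..} \<times> {1..B}"

(* \<xi> t i is the i-th sample of the batch drawn in iteration t. *)
definition iid_samples ::
  "'w measure \<Rightarrow> 's measure \<Rightarrow> nat \<Rightarrow> (nat \<Rightarrow> nat \<Rightarrow> 'w \<Rightarrow> 's) \<Rightarrow> bool" where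
  "iid_samples W P B \<xi> \<longleftrightarrow>
     prob_space W \<and>
     prob_space.indep_vars W (\<lambda>_. P) (\<lambda>(t, i). \<xi> t i) (sample_indices B) \<and>
     (\<forall>(t, i) \<in> sample_indices B. distr W P (\<xi> t i) = P)"

primrec sgda ::
  "('a::euclidean_space \<times> 'b::euclidean_space \<Rightarrow> 's \<Rightarrow> 'a \<times> 'b) \<Rightarrow> 'b set \<Rightarrow> real \<Rightarrow> real \<Rightarrow> nat
   \<Rightarrow> 'a \<Rightarrow> 'b \<Rightarrow> (nat \<Rightarrow> nat \<Rightarrow> 'w \<Rightarrow> 's) \<Rightarrow> nat \<Rightarrow> 'w \<Rightarrow> 'a \<times> 'b" where
  "sgda G Y \<eta>x \<eta>y B x0 y0 \<xi> 0 \<omega> = (x0, y0)"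
| "sgda G Y \<eta>x \<eta>y B x0 y0 \<xi> (Suc t) \<omega> =
     (let z = sgda G Y \<eta>x \<eta>y B x0 y0 \<xi> t \<omega>;
          g = (1 / real B) *\<^sub>R (\<Sum>i = 1..B. G z (\<xi> (Suc t) i \<omega>))
      in (fst z - \<eta>x *\<^sub>R fst g, closest_point Y (snd z + \<eta>y *\<^sub>R snd g)))"

(* One oracle call per sample used in iterations 1, ..., T. *)
definition sgda_oracle_calls :: "nat \<Rightarrow> nat \<Rightarrow> nat" where
  "sgda_oracle_calls B T = card {(t, i) \<in> sample_indices B. t \<le> T}"

(* The output is X J, where J is uniform on {1..T} and independent of the samples.
   Integrability is required because the Bochner integral is 0 for a non-integrable function. *)
definition random_output_stationary ::
  "'w measure \<Rightarrow> (nat \<Rightarrow> 'w \<Rightarrow> 'a::euclidean_space) \<Rightarrow> nat \<Rightarrow> ('a \<Rightarrow> real) \<Rightarrow> real \<Rightarrow> real \<Rightarrow> bool" where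
  "random_output_stationary W X T \<Phi> l \<epsilon> \<longleftrightarrow>
     (let Q = W \<Otimes>\<^sub>M measure_pmf (pmf_of_set {1..T});
          h = (\<lambda>(\<omega>, j). (norm (grad (moreau_envelope (1 / (2 * l)) \<Phi>) (X j \<omega>)))\<^sup>2)
      in integrable Q h \<and> (\<integral>q. h q \<partial>Q) \<le> \<epsilon>\<^sup>2)"

(* v = Theta(r), with hidden constants a and b *)
definition theta_with :: "real \<Rightarrow> real \<Rightarrow> real \<Rightarrow> real \<Rightarrow> bool" where
  "theta_with a b r v \<longleftrightarrow> 0 < a \<and> a \<le> b \<and> a * r \<le> v \<and> v \<le> b * r"

(* The constants hidden by Theta and O. They are explicit numbers, not existentially quantified
   in front of an instance: an existential there would be in the scope of the index types of
   the vectors, and the constants could then depend on the dimensions. The parameter k bounds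
   the ratios eps / sigma and eps / (l * D). No choice of constants is uniform in these ratios:
   if sigma / eps tends to 0, then eps^2 / (l * sigma^2) exceeds every stable ascent step, and
   if D * l / eps tends to 0, then eps^4 / (l^3 * D^2 * (L^2 + sigma^2)) exceeds every stable
   descent step. For k = 1 they are absolute. *)
definition eta_x_lo :: "real \<Rightarrow> real" where "eta_x_lo k = 1 / (10 ^ 16 * k ^ 4)"
definition eta_x_hi :: "real \<Rightarrow> real" where "eta_x_hi k = 1 / (10 ^ 15 * k ^ 4)"
definition eta_y_lo :: "real \<Rightarrow> real" where "eta_y_lo k = 1 / (10 ^ 6 * k ^ 2)"
definition eta_y_hi :: "real \<Rightarrow> real" where "eta_y_hi k = 1 / (10 ^ 5 * k ^ 2)"
definition complexity_const :: "real \<Rightarrow> real" where "complexity_const k = 10 ^ 24 * k ^ 4"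

end

(* Put b = eta_x / eta_y and follow the saddle value
     U(x, y) = min_w max_{v in Y} f(w, v) + l |w - x|^2 + l b (|v - y|^2 - 2 |v - y0|^2),
   which differs from the Moreau envelope of Phi at x by O(l b D^2).  The sign of |v - y|^2 makes U
   decrease when y moves towards v; the term -2 |v - y0|^2 makes the inner problem strongly concave,
   so that the noise in y enters only to second order.  At the saddle point (w, v) one has
   grad_x f(w, v) = 2 l (x - w), and one step of SGDA changes U in mean by at most
     eta_x (-l^2 |x - w|^2 + O(l^2 b D^2 + l eta_x (L^2 + sigma^2) + l eta_y sigma^2)),
   where 2 l |x - w| is the norm of the gradient of the envelope up to O(l sqrt(b) D).
   The usual comparison of blocks of iterates would ask for a smaller eta_x when sigma / eps is large;
   here l^2 b D^2 = O(eps^2) is enough.  Averaging over T steps costs l b D^2 / (eta_x T), which is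
   negligible for T >= N = O(l^2 D^2 sigma^2 / eps^4).  For T < N the hypothesis on T makes
   Delta_Phi = O(eps^2 / l), and U, hence the envelope, stays within O(eps^2 / l) of inf of the
   envelope during N steps, so that every single gradient is already small. *)
theory Submission
  imports Defs
begin

section \<open>Smooth functions\<close>

text \<open>The weight b is forced by a cancellation. To first order, a step against grad_x f
  changes l |w - x|^2 by 2 l eta_x <w - x, grad_x f>, and a step along grad_y f changes l b |v -
  y|^2 by -2 l b eta_y <v - y, grad_y f>. Since b eta_y = eta_x, both carry the factor 2 l eta_x,
  and smoothness in x together with concavity in y bounds their sum by 2 l eta_x (f(w, y) - f(x, v)
  + l/2 |x - w|^2): the value f(x, y) drops out, so no estimate of how far y is from maximising f(x,
  .) enters. Now f(w, y) <= f(w, v) + O(l b D^2) by maximality of v, and f(x, v) >= f(w, v) + 3/2 l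
  |x - w|^2 by stationarity of w; what is left is -2 l^2 eta_x |x - w|^2, half of which pays for the
  cross terms. The obstacle is that the maximiser reacts to the new y and hence to the noise. Only w
  - x and y - v, both fixed before the sample is drawn, may multiply the noise linearly; the
  reaction v' - v is paid for by the quadratic growth l b |v' - v|^2 of the inner maximum.\<close>

text \<open>This replaces every passage to the limit t -> 0: an inequality along a segment is
  divided by t, and the remainder is linear in t.\<close>

lemma le_if_le_add_small_mult:
  fixes a b c :: real
  assumes "\<And>t. 0 < t \<Longrightarrow> t \<le> 1 \<Longrightarrow> a \<le> b + c * t"
  shows "a \<le> b"
proof (rule field_le_epsilon)
  fix e :: real assume e: "0 < e"
  define t where "t = min 1 (e / (\<bar>c\<bar> + 1))"
  have t: "0 < t" "t \<le> 1" "t \<le> e / (\<bar>c\<bar> + 1)" using e by (auto simp: t_def)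
  have "c * t \<le> (\<bar>c\<bar> + 1) * t" using t by (intro mult_right_mono) auto
  also have "\<dots> \<le> e" using t(3) by (simp add: field_simps)
  finally show "a \<le> b + e" using assms[OF t(1,2)] by linarith
qed

lemma grad_eqI: "GDERIV g z :> D \<Longrightarrow> grad g z = D"
proof -
  assume a: "GDERIV g z :> D"
  have "D' = D" if "GDERIV g z :> D'" for D'
  proof -
    have "(\<lambda>h. inner h D') = (\<lambda>h. inner h D)"
      using has_derivative_unique[of g "\<lambda>h. inner h D'" z "\<lambda>h. inner h D"] that a
      by (simp add: gderiv_def)
    then have "inner (D' - D) D' = inner (D' - D) D" by metis
    then have "inner (D' - D) (D' - D) = 0" by (simp add: inner_diff_right)
    then show ?thesis by simp
  qed
  then show ?thesis using a unfolding grad_def by (intro the_equality)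
qed

lemma smooth_fun_line_derivative:
  assumes "smooth_fun l g"
  shows "((\<lambda>t. g (z + t *\<^sub>R d)) has_real_derivative inner d (grad g (z + t *\<^sub>R d))) (at t)"
proof -
  obtain D where D: "GDERIV g (z + t *\<^sub>R d) :> D" using assms unfolding smooth_fun_def by blast
  have "(g has_derivative (\<lambda>h. inner h (grad g (z + t *\<^sub>R d)))) (at (z + t *\<^sub>R d))"
    using D grad_eqI[OF D] by (simp add: gderiv_def)
  moreover have "((\<lambda>t. z + t *\<^sub>R d) has_derivative (\<lambda>s. s *\<^sub>R d)) (at t)"
    by (auto intro!: derivative_eq_intros)
  ultimately have "((\<lambda>t. g (z + t *\<^sub>R d)) has_derivative (\<lambda>s. inner (s *\<^sub>R d) (grad g (z + t *\<^sub>R d)))) (at t)"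
    using has_derivative_compose by blast
  then show ?thesis
    unfolding has_field_derivative_def by (simp add: mult_commute_abs)
qed

lemma smooth_fun_lipschitz_grad:
  "smooth_fun l g \<Longrightarrow> norm (grad g z - grad g z') \<le> l * norm (z - z')"
  by (simp add: smooth_fun_def)

lemma smooth_fun_upper:
  assumes "smooth_fun l g"
  shows "g z' \<le> g z + inner (z' - z) (grad g z) + l / 2 * (norm (z' - z))\<^sup>2"
proof -
  let ?d = "z' - z"
  let ?p = "\<lambda>t. g (z + t *\<^sub>R ?d) - t * inner ?d (grad g z) - l / 2 * t\<^sup>2 * (norm ?d)\<^sup>2"
  have "?p 1 \<le> ?p 0"
  proof (rule DERIV_nonpos_imp_nonincreasing[of 0 1 ?p])
    fix t :: real assume t: "0 \<le> t" "t \<le> 1"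
    have "inner ?d (grad g (z + t *\<^sub>R ?d)) - inner ?d (grad g z)
        = inner ?d (grad g (z + t *\<^sub>R ?d) - grad g z)" by (simp add: inner_diff_right)
    also have "\<dots> \<le> norm ?d * norm (grad g (z + t *\<^sub>R ?d) - grad g z)" by (rule norm_cauchy_schwarz)
    also have "\<dots> \<le> norm ?d * (l * norm (z + t *\<^sub>R ?d - z))"
      by (intro mult_left_mono smooth_fun_lipschitz_grad assms) auto
    also have "\<dots> = l * t * (norm ?d)\<^sup>2" using t by (simp add: power2_eq_square)
    finally have "inner ?d (grad g (z + t *\<^sub>R ?d)) - inner ?d (grad g z) - l * t * (norm ?d)\<^sup>2 \<le> 0" by simp
    then show "\<exists>y. (?p has_real_derivative y) (at t) \<and> y \<le> 0"
      by (intro exI[of _ "inner ?d (grad g (z + t *\<^sub>R ?d)) - inner ?d (grad g z) - l * t * (norm ?d)\<^sup>2"] conjI)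
        (auto intro!: derivative_eq_intros smooth_fun_line_derivative[OF assms])
  qed simp
  then show ?thesis by simp
qed

lemma smooth_fun_lower:
  assumes "smooth_fun l g"
  shows "g z + inner (z' - z) (grad g z) - l / 2 * (norm (z' - z))\<^sup>2 \<le> g z'"
proof -
  let ?d = "z' - z"
  let ?p = "\<lambda>t. g (z + t *\<^sub>R ?d) - t * inner ?d (grad g z) + l / 2 * t\<^sup>2 * (norm ?d)\<^sup>2"
  have "?p 0 \<le> ?p 1"
  proof (rule DERIV_nonneg_imp_nondecreasing[of 0 1 ?p])
    fix t :: real assume t: "0 \<le> t" "t \<le> 1"
    have "\<bar>inner ?d (grad g (z + t *\<^sub>R ?d) - grad g z)\<bar> \<le> norm ?d * norm (grad g (z + t *\<^sub>R ?d) - grad g z)"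
      by (rule Cauchy_Schwarz_ineq2)
    also have "\<dots> \<le> norm ?d * (l * norm (z + t *\<^sub>R ?d - z))"
      by (intro mult_left_mono smooth_fun_lipschitz_grad assms) auto
    also have "\<dots> = l * t * (norm ?d)\<^sup>2" using t by (simp add: power2_eq_square)
    finally have "inner ?d (grad g (z + t *\<^sub>R ?d)) - inner ?d (grad g z) + l * t * (norm ?d)\<^sup>2 \<ge> 0"
      by (simp add: inner_diff_right)
    then show "\<exists>y. (?p has_real_derivative y) (at t) \<and> 0 \<le> y"
      by (intro exI[of _ "inner ?d (grad g (z + t *\<^sub>R ?d)) - inner ?d (grad g z) + l * t * (norm ?d)\<^sup>2"] conjI)
        (auto intro!: derivative_eq_intros smooth_fun_line_derivative[OF assms])
  qed simp
  then show ?thesis by simp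
qed

text \<open>Because smoothness is joint in both blocks, f(x, .) - f(w, .) has derivative at most l
  |x - w| |y' - y| along the segment from y to y'. This cross term is what couples displacements in
  y to displacements in x.\<close>

lemma smooth_fun_mixed_difference:
  fixes f :: "'a::real_inner \<times> 'b::real_inner \<Rightarrow> real"
  assumes "smooth_fun l f"
  shows "f (x, y') - f (x, y) - (f (w, y') - f (w, y)) \<le> l * norm (x - w) * norm (y' - y)"
proof -
  let ?d = "(0, y' - y) :: 'a \<times> 'b"
  let ?g = "\<lambda>u t. grad f ((u, y) + t *\<^sub>R ?d)"
  let ?p = "\<lambda>t. f ((x, y) + t *\<^sub>R ?d) - f ((w, y) + t *\<^sub>R ?d) - t * (l * norm (x - w) * norm (y' - y))"
  have "?p 1 \<le> ?p 0"
  proof (rule DERIV_nonpos_imp_nonincreasing[of 0 1 ?p])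
    fix t :: real
    have "inner ?d (?g x t - ?g w t) \<le> norm ?d * norm (?g x t - ?g w t)" by (rule norm_cauchy_schwarz)
    also have "\<dots> \<le> norm ?d * (l * norm ((x, y) + t *\<^sub>R ?d - ((w, y) + t *\<^sub>R ?d)))"
      by (intro mult_left_mono smooth_fun_lipschitz_grad assms) auto
    also have "\<dots> = l * norm (x - w) * norm (y' - y)" by (simp add: norm_Pair)
    finally have "inner ?d (?g x t) - inner ?d (?g w t) - l * norm (x - w) * norm (y' - y) \<le> 0"
      by (simp add: inner_diff_right)
    then show "\<exists>y. (?p has_real_derivative y) (at t) \<and> y \<le> 0"
      by (intro exI[of _ "inner ?d (?g x t) - inner ?d (?g w t) - l * norm (x - w) * norm (y' - y)"] conjI)
        (auto simp del: scaleR_Pair add_Pair intro!: derivative_eq_intros smooth_fun_line_derivative[OF assms])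
  qed simp
  then show ?thesis by simp
qed

section \<open>The maximum function and its Moreau envelope\<close>

lemma GDERIV_if_quadratic_remainder:
  fixes g :: "'a::real_inner \<Rightarrow> real"
  assumes "\<And>x'. \<bar>g x' - g x - inner (x' - x) D\<bar> \<le> C * (norm (x' - x))\<^sup>2"
  shows "GDERIV g x :> D"
  unfolding gderiv_def has_derivative_at_alt
proof (intro conjI allI impI)
  show "bounded_linear (\<lambda>h. inner h D)" by (rule bounded_linear_inner_left)
  fix e :: real assume e: "0 < e"
  show "\<exists>d>0. \<forall>y. norm (y - x) < d \<longrightarrow> norm (g y - g x - inner (y - x) D) \<le> e * norm (y - x)"
  proof (intro exI[of _ "e / (\<bar>C\<bar> + 1)"] conjI allI impI)
    show "0 < e / (\<bar>C\<bar> + 1)" using e by simp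
    fix y assume y: "norm (y - x) < e / (\<bar>C\<bar> + 1)"
    have "C * norm (y - x) \<le> (\<bar>C\<bar> + 1) * norm (y - x)" by (intro mult_right_mono) auto
    also have "\<dots> \<le> e" using y by (simp add: field_simps)
    finally have "C * (norm (y - x))\<^sup>2 \<le> e * norm (y - x)"
      by (simp add: power2_eq_square mult_right_mono flip: mult.assoc)
    then show "norm (g y - g x - inner (y - x) D) \<le> e * norm (y - x)"
      using assms[of y] by simp
  qed
qed

text \<open>The exact strong convexity identity of the squared norm; it serves the proximal
  objective in x and the penalty in y.\<close>

lemma norm_segment_sq:
  fixes a b x :: "'a::real_inner"
  shows "(norm ((1 - t) *\<^sub>R a + t *\<^sub>R b - x))\<^sup>2
       = (1 - t) * (norm (a - x))\<^sup>2 + t * (norm (b - x))\<^sup>2 - t * (1 - t) * (norm (a - b))\<^sup>2"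
  unfolding power2_norm_eq_inner by (simp add: algebra_simps inner_commute)

locale nonconvex_concave =
  fixes f :: "'a::euclidean_space \<times> 'b::euclidean_space \<Rightarrow> real"
    and Y :: "'b set" and l L D :: real
  assumes l_pos: "0 < l"
    and smooth: "smooth_fun l f"
    and lipschitz: "\<And>y. y \<in> Y \<Longrightarrow> L-lipschitz_on UNIV (\<lambda>x. f (x, y))"
    and concave: "\<And>x. concave_on UNIV (\<lambda>y. f (x, y))"
    and Y_nonempty: "Y \<noteq> {}"
    and closed_Y: "closed Y"
    and convex_Y: "convex Y"
    and bounded_Y: "bounded Y"
    and norm_diff_Y: "\<And>u v. u \<in> Y \<Longrightarrow> v \<in> Y \<Longrightarrow> norm (u - v) \<le> D"
begin

text \<open>The summand q sits inside the maximum so that Phi (q = 0) and the penalised maximum (q =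
  \<open>penalty\<close>) share one theory of envelopes.\<close>

definition max_plus :: "('b \<Rightarrow> real) \<Rightarrow> 'a \<Rightarrow> real" where
  "max_plus q w = (SUP v\<in>Y. f (w, v) + q v)"

abbreviation env_plus :: "('b \<Rightarrow> real) \<Rightarrow> 'a \<Rightarrow> real" where
  "env_plus q \<equiv> moreau_envelope (1 / (2 * l)) (max_plus q)"

(* A minimiser of the l-strongly convex proximal objective satisfies the quadratic growth
   automatically (is_prox_exists), so m is just the proximal point of x. *)
definition is_prox :: "('b \<Rightarrow> real) \<Rightarrow> 'a \<Rightarrow> 'a \<Rightarrow> bool" where
  "is_prox q x m \<longleftrightarrow> (\<forall>w. max_plus q m + l * (norm (m - x))\<^sup>2 + l / 2 * (norm (w - m))\<^sup>2
      \<le> max_plus q w + l * (norm (w - x))\<^sup>2)"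

abbreviation gx :: "'a \<Rightarrow> 'b \<Rightarrow> 'a" where "gx x y \<equiv> fst (grad f (x, y))"
abbreviation gy :: "'a \<Rightarrow> 'b \<Rightarrow> 'b" where "gy x y \<equiv> snd (grad f (x, y))"

lemma max_fun_eq: "max_fun f Y = max_plus (\<lambda>_. 0)"
  by (simp add: max_fun_def max_plus_def fun_eq_iff)

lemma L_nonneg: "0 \<le> L"
  using Y_nonempty lipschitz unfolding lipschitz_on_def by blast

lemma D_nonneg: "0 \<le> D"
  using Y_nonempty norm_diff_Y by (metis all_not_in_conv norm_ge_zero order_trans)

lemma continuous_f: "continuous_on S f"
proof -
  have "\<exists>D. GDERIV f z :> D" for z using smooth unfolding smooth_fun_def by blast
  then have "continuous (at z) f" for z using has_derivative_continuous unfolding gderiv_def by blast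
  then show ?thesis by (simp add: continuous_at_imp_continuous_on)
qed

lemma compact_Y: "compact Y"
  using closed_Y bounded_Y by (simp add: compact_eq_bounded_closed)

lemma max_plus_attained:
  assumes q: "continuous_on Y q"
  obtains v where "v \<in> Y" "max_plus q w = f (w, v) + q v"
    "\<And>v'. v' \<in> Y \<Longrightarrow> f (w, v') + q v' \<le> f (w, v) + q v"
proof -
  have "continuous_on Y (\<lambda>v. f (w, v) + q v)"
    by (intro continuous_intros q continuous_on_compose2[OF continuous_f[of UNIV]]) auto
  from continuous_attains_sup[OF compact_Y Y_nonempty this]
  obtain v where v: "v \<in> Y" "\<And>v'. v' \<in> Y \<Longrightarrow> f (w, v') + q v' \<le> f (w, v) + q v" by blast
  then have "max_plus q w = f (w, v) + q v"
    unfolding max_plus_def by (intro cSup_eq_maximum) auto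
  with v that show thesis by blast
qed

lemma max_plus_ge:
  assumes "continuous_on Y q" "v \<in> Y"
  shows "f (w, v) + q v \<le> max_plus q w"
  using max_plus_attained[OF assms(1), of w] assms(2) by metis

section \<open>Inequalities for f in each block of variables\<close>

lemma lipschitz_f: "y \<in> Y \<Longrightarrow> f (x, y) \<le> f (x', y) + L * norm (x - x')"
  using lipschitz_onD[OF lipschitz, of y x x'] by (auto simp: dist_norm)

lemma f_upper_x: "f (x', y) \<le> f (x, y) + inner (x' - x) (gx x y) + l / 2 * (norm (x' - x))\<^sup>2"
  using smooth_fun_upper[OF smooth, of "(x', y)" "(x, y)"] by (cases "grad f (x, y)") (simp add: norm_Pair)

lemma f_lower_x: "f (x, y) + inner (x' - x) (gx x y) - l / 2 * (norm (x' - x))\<^sup>2 \<le> f (x', y)"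
  using smooth_fun_lower[OF smooth, of "(x, y)" "(x', y)"] by (cases "grad f (x, y)") (simp add: norm_Pair)

lemma f_upper_y: "f (x, y') \<le> f (x, y) + inner (y' - y) (gy x y) + l / 2 * (norm (y' - y))\<^sup>2"
  using smooth_fun_upper[OF smooth, of "(x, y')" "(x, y)"] by (cases "grad f (x, y)") (simp add: norm_Pair)

lemma f_lower_y: "f (x, y) + inner (y' - y) (gy x y) - l / 2 * (norm (y' - y))\<^sup>2 \<le> f (x, y')"
  using smooth_fun_lower[OF smooth, of "(x, y)" "(x, y')"] by (cases "grad f (x, y)") (simp add: norm_Pair)

lemma concave_segment:
  assumes "0 \<le> t" "t \<le> 1"
  shows "(1 - t) * f (x, a) + t * f (x, b) \<le> f (x, (1 - t) *\<^sub>R a + t *\<^sub>R b)"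
  using concave[of x] assms unfolding concave_on_iff by simp

text \<open>At a fraction t of the segment, concavity bounds f from below and smoothness from above;
  dividing by t and letting t tend to 0 leaves the tangent inequality.\<close>

lemma f_concave_y: "f (x, y') \<le> f (x, y) + inner (y' - y) (gy x y)"
proof (rule le_if_le_add_small_mult)
  fix t :: real assume t: "0 < t" "t \<le> 1"
  have eq: "(1 - t) *\<^sub>R y + t *\<^sub>R y' - y = t *\<^sub>R (y' - y)" by (simp add: algebra_simps)
  have n: "(norm (t *\<^sub>R (y' - y)))\<^sup>2 = t * t * (norm (y' - y))\<^sup>2"
    by (simp add: power_mult_distrib power2_eq_square)
  have "(1 - t) * f (x, y) + t * f (x, y') \<le> f (x, (1 - t) *\<^sub>R y + t *\<^sub>R y')"
    using t by (intro concave_segment) auto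
  also have "\<dots> \<le> f (x, y) + t * inner (y' - y) (gy x y) + l / 2 * (norm (t *\<^sub>R (y' - y)))\<^sup>2"
    using f_upper_y[of x "(1 - t) *\<^sub>R y + t *\<^sub>R y'" y] unfolding eq by simp
  finally have "t * f (x, y') \<le> t * (f (x, y) + inner (y' - y) (gy x y) + l / 2 * (norm (y' - y))\<^sup>2 * t)"
    unfolding n by (simp add: left_diff_distrib distrib_left mult_ac)
  then show "f (x, y') \<le> f (x, y) + inner (y' - y) (gy x y) + l / 2 * (norm (y' - y))\<^sup>2 * t"
    using t by simp
qed

text \<open>A short move along the gradient itself raises f by t |gx|^2 up to second order, while
  the Lipschitz bound allows only L t |gx|.\<close>

lemma norm_gx_le:
  assumes "y \<in> Y"
  shows "norm (gx x y) \<le> L"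
proof -
  let ?d = "gx x y"
  have "(norm ?d)\<^sup>2 \<le> L * norm ?d"
  proof (rule le_if_le_add_small_mult)
    fix t :: real assume t: "0 < t" "t \<le> 1"
    have "f (x, y) + inner (t *\<^sub>R ?d) ?d - l / 2 * (norm (t *\<^sub>R ?d))\<^sup>2 \<le> f (x + t *\<^sub>R ?d, y)"
      using f_lower_x[of x y "x + t *\<^sub>R ?d"] by simp
    also have "\<dots> \<le> f (x, y) + L * norm (t *\<^sub>R ?d)"
      using lipschitz_f[OF assms, of "x + t *\<^sub>R ?d" x] by simp
    finally have "t * (norm ?d)\<^sup>2 - l / 2 * (t * t * (norm ?d)\<^sup>2) \<le> L * (t * norm ?d)"
      using t by (simp add: power_mult_distrib power2_norm_eq_inner) (simp add: power2_eq_square)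
    then have "t * (norm ?d)\<^sup>2 \<le> t * (L * norm ?d + l / 2 * (norm ?d)\<^sup>2 * t)"
      by (simp add: algebra_simps)
    then show "(norm ?d)\<^sup>2 \<le> L * norm ?d + l / 2 * (norm ?d)\<^sup>2 * t" using t by simp
  qed
  then show ?thesis
    using L_nonneg by (cases "norm ?d = 0") (auto simp: power2_eq_square)
qed

section \<open>Weak convexity of the maximum and existence of proximal points\<close>

lemma max_plus_lipschitz:
  assumes "continuous_on Y q"
  shows "max_plus q w \<le> max_plus q w' + L * norm (w - w')"
proof -
  obtain v where v: "v \<in> Y" "max_plus q w = f (w, v) + q v" using max_plus_attained[OF assms] by metis
  then show ?thesis using lipschitz_f[OF v(1), of w w'] max_plus_ge[OF assms v(1), of w'] by linarith
qed

lemma max_plus_lower: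
  assumes "continuous_on Y q" "v \<in> Y" "max_plus q w = f (w, v) + q v"
  shows "max_plus q w + inner (w' - w) (gx w v) - l / 2 * (norm (w' - w))\<^sup>2 \<le> max_plus q w'"
  using f_lower_x[of w v w'] max_plus_ge[OF assms(1,2), of w'] assms(3) by linarith

text \<open>Let v be a maximiser at the intermediate point c. The quadratic lower models with slope
  \<open>gx c v\<close> hold at both ends, and their linear terms cancel in the convex combination
  because c is that combination.\<close>

lemma max_plus_segment:
  assumes q: "continuous_on Y q" and t: "0 \<le> t" "t \<le> 1"
  shows "max_plus q ((1 - t) *\<^sub>R a + t *\<^sub>R b)
       \<le> (1 - t) * max_plus q a + t * max_plus q b + l / 2 * (t * (1 - t)) * (norm (a - b))\<^sup>2"
proof -
  obtain c where c: "c = (1 - t) *\<^sub>R a + t *\<^sub>R b" by blast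
  obtain v where v: "v \<in> Y" "max_plus q c = f (c, v) + q v" using max_plus_attained[OF q] by metis
  let ?p = "gx c v"
  have eq: "a - c = t *\<^sub>R (a - b)" "b - c = (1 - t) *\<^sub>R (b - a)" by (simp_all add: c algebra_simps)
  have "(1 - t) * (max_plus q c + inner (a - c) ?p - l / 2 * (norm (a - c))\<^sup>2)
      + t * (max_plus q c + inner (b - c) ?p - l / 2 * (norm (b - c))\<^sup>2)
      \<le> (1 - t) * max_plus q a + t * max_plus q b"
    using t by (intro add_mono mult_left_mono max_plus_lower[OF q v]) auto
  moreover have "(1 - t) * (inner (a - c) ?p) + t * inner (b - c) ?p = 0"
    unfolding eq by (simp add: algebra_simps)
  moreover have "(1 - t) * (l / 2 * (norm (a - c))\<^sup>2) + t * (l / 2 * (norm (b - c))\<^sup>2)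
     = l / 2 * (t * (1 - t)) * (norm (a - b))\<^sup>2"
    unfolding eq norm_scaleR power_mult_distrib power2_abs norm_minus_commute[of b a]
    by (simp add: power2_eq_square field_simps)
  moreover have "(1 - t) * (m + i - p) + t * (m + j - r) = m + ((1 - t) * i + t * j) - ((1 - t) * p + t * r)"
    for m i j p r :: real
    by (simp add: algebra_simps)
  ultimately show ?thesis unfolding c[symmetric] by simp
qed

text \<open>The growth constant l / 2 is l - l / 2: the proximal term gains l t (1 - t) |m - w|^2 on
  a segment, of which the weak convexity of the maximum takes half.\<close>

lemma is_prox_exists:
  assumes q: "continuous_on Y q"
  shows "\<exists>m. is_prox q x m"
proof -
  let ?F = "\<lambda>w. max_plus q w + l * (norm (w - x))\<^sup>2"
  have "L-lipschitz_on UNIV (max_plus q)"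
    using max_plus_lipschitz[OF q] L_nonneg
    by (intro lipschitz_onI) (simp_all add: dist_norm abs_le_iff, metis add.commute norm_minus_commute diff_le_eq)
  then have "continuous_on UNIV (max_plus q)" by (rule lipschitz_on_continuous_on)
  \<comment> \<open>Beyond the radius L / l the proximal term outweighs whatever the L-Lipschitz
    maximum can gain over the centre x.\<close>
  then have "continuous_on (cball x (L / l)) ?F"
    by (intro continuous_intros) (auto intro: continuous_on_subset)
  moreover have "cball x (L / l) \<noteq> {}" using L_nonneg l_pos by (simp add: not_less)
  ultimately obtain m where m: "m \<in> cball x (L / l)" "\<And>w. w \<in> cball x (L / l) \<Longrightarrow> ?F m \<le> ?F w"
    using continuous_attains_inf[of "cball x (L / l)" ?F] by auto
  have min: "?F m \<le> ?F w" for w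
  proof (cases "w \<in> cball x (L / l)")
    case False
    then have "L \<le> l * norm (w - x)" using l_pos by (simp add: dist_norm norm_minus_commute field_simps)
    then have "L * norm (w - x) \<le> l * (norm (w - x))\<^sup>2"
      by (simp add: power2_eq_square mult_right_mono flip: mult.assoc)
    moreover have "?F m \<le> ?F x" using L_nonneg l_pos by (intro m) simp
    ultimately show ?thesis using max_plus_lipschitz[OF q, of x w] by (simp add: norm_minus_commute)
  qed (rule m)
  have "?F m + l / 2 * (norm (w - m))\<^sup>2 \<le> ?F w" for w
  proof (rule le_if_le_add_small_mult)
    fix t :: real assume t: "0 < t" "t \<le> 1"
    have "?F m \<le> ?F ((1 - t) *\<^sub>R m + t *\<^sub>R w)" by (rule min)
    also have "\<dots> \<le> (1 - t) * ?F m + t * ?F w - l / 2 * (t * (1 - t)) * (norm (m - w))\<^sup>2"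
      using max_plus_segment[OF q, of t m w] t unfolding norm_segment_sq by (simp add: algebra_simps diff_divide_distrib)
    finally have "t * (?F m + l / 2 * (norm (w - m))\<^sup>2) \<le> t * (?F w + l / 2 * (norm (w - m))\<^sup>2 * t)"
      unfolding norm_minus_commute[of m w] by (simp add: algebra_simps diff_divide_distrib)
    then show "?F m + l / 2 * (norm (w - m))\<^sup>2 \<le> ?F w + l / 2 * (norm (w - m))\<^sup>2 * t"
      using t by (simp add: mult_le_cancel_left_pos)
  qed
  then show ?thesis unfolding is_prox_def by blast
qed

section \<open>Value and gradient of the Moreau envelope\<close>

lemma moreau_envelope_alt: "moreau_envelope (1 / (2 * l)) g x = (INF w. g w + l * (norm (w - x))\<^sup>2)"
  using l_pos by (simp add: moreau_envelope_def mult.commute)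

lemma is_prox_le: "is_prox q x m \<Longrightarrow> max_plus q m + l * (norm (m - x))\<^sup>2 \<le> max_plus q w + l * (norm (w - x))\<^sup>2"
proof -
  assume "is_prox q x m"
  then have "max_plus q m + l * (norm (m - x))\<^sup>2 + l / 2 * (norm (w - m))\<^sup>2 \<le> max_plus q w + l * (norm (w - x))\<^sup>2"
    unfolding is_prox_def by blast
  moreover have "0 \<le> l / 2 * (norm (w - m))\<^sup>2" using l_pos by simp
  ultimately show ?thesis by linarith
qed

lemma env_plus_eq:
  assumes "is_prox q x m"
  shows "env_plus q x = max_plus q m + l * (norm (m - x))\<^sup>2"
  unfolding moreau_envelope_alt using is_prox_le[OF assms] by (intro cInf_eq_minimum) auto

lemma env_plus_le:
  assumes "continuous_on Y q"
  shows "env_plus q x \<le> max_plus q w + l * (norm (w - x))\<^sup>2"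
proof -
  obtain m where "is_prox q x m" using is_prox_exists[OF assms] by blast
  then show ?thesis using env_plus_eq is_prox_le by metis
qed

text \<open>The proximal point is translated along with x, so the quadratic term is unchanged and
  only the maximum varies.\<close>

lemma env_plus_lipschitz:
  assumes q: "continuous_on Y q"
  shows "env_plus q x \<le> env_plus q x' + L * norm (x - x')"
proof -
  obtain m where m: "is_prox q x' m" using is_prox_exists[OF q] by blast
  have "env_plus q x \<le> max_plus q (m + (x - x')) + l * (norm (m + (x - x') - x))\<^sup>2"
    by (rule env_plus_le[OF q])
  also have "max_plus q (m + (x - x')) \<le> max_plus q m + L * norm (x - x')"
    using max_plus_lipschitz[OF q, of "m + (x - x')" m] by simp
  finally show ?thesis using env_plus_eq[OF m] by simp
qed

lemma max_plus_mono:
  assumes q: "continuous_on Y q" "continuous_on Y q'" and le: "\<And>v. v \<in> Y \<Longrightarrow> q v \<le> q' v + e"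
  shows "max_plus q x \<le> max_plus q' x + e"
proof -
  obtain v where v: "v \<in> Y" "max_plus q x = f (x, v) + q v" using max_plus_attained[OF q(1)] by metis
  then show ?thesis using le[OF v(1)] max_plus_ge[OF q(2) v(1), of x] by linarith
qed

lemma env_plus_mono:
  assumes q: "continuous_on Y q" "continuous_on Y q'" and le: "\<And>v. v \<in> Y \<Longrightarrow> q v \<le> q' v + e"
  shows "env_plus q x \<le> env_plus q' x + e"
proof -
  obtain m where m: "is_prox q' x m" using is_prox_exists[OF q(2)] by blast
  show ?thesis using env_plus_le[OF q(1), of x m] env_plus_eq[OF m] max_plus_mono[OF q le, of m] by linarith
qed

text \<open>The two growth inequalities, each tested at the other proximal point, add up to l |m' -
  m|^2 <= 2 l <m' - m, x' - x>.\<close>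

lemma is_prox_lipschitz:
  assumes "is_prox q x m" "is_prox q x' m'"
  shows "norm (m' - m) \<le> 2 * norm (x' - x)"
proof -
  have a: "max_plus q m + l * (norm (m - x))\<^sup>2 + l / 2 * (norm (m' - m))\<^sup>2 \<le> max_plus q m' + l * (norm (m' - x))\<^sup>2"
    and b: "max_plus q m' + l * (norm (m' - x'))\<^sup>2 + l / 2 * (norm (m - m'))\<^sup>2 \<le> max_plus q m + l * (norm (m - x'))\<^sup>2"
    using assms unfolding is_prox_def by auto
  have "(norm (m' - x))\<^sup>2 - (norm (m - x))\<^sup>2 + (norm (m - x'))\<^sup>2 - (norm (m' - x'))\<^sup>2 = 2 * inner (m' - m) (x' - x)"
    unfolding power2_norm_eq_inner by (simp add: algebra_simps inner_commute)
  then have "l * ((norm (m' - x))\<^sup>2 - (norm (m - x))\<^sup>2 + (norm (m - x'))\<^sup>2 - (norm (m' - x'))\<^sup>2) = l * (2 * inner (m' - m) (x' - x))"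
    by simp
  then have "l * (norm (m' - m))\<^sup>2 \<le> l * (2 * inner (m' - m) (x' - x))"
    using a b by (simp add: algebra_simps norm_minus_commute[of m m'])
  then have "(norm (m' - m))\<^sup>2 \<le> 2 * inner (m' - m) (x' - x)" using l_pos by simp
  also have "\<dots> \<le> 2 * (norm (m' - m) * norm (x' - x))" using norm_cauchy_schwarz by simp
  finally show ?thesis by (cases "norm (m' - m) = 0") (auto simp: power2_eq_square)
qed

lemma env_plus_upper:
  assumes q: "continuous_on Y q" and m: "is_prox q x m"
  shows "env_plus q x' \<le> env_plus q x + inner (x' - x) ((2 * l) *\<^sub>R (x - m)) + l * (norm (x' - x))\<^sup>2"
proof -
  have "(norm (m - x'))\<^sup>2 = (norm (m - x))\<^sup>2 + 2 * inner (x' - x) (x - m) + (norm (x' - x))\<^sup>2"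
    unfolding power2_norm_eq_inner by (simp add: algebra_simps inner_commute)
  then have "l * (norm (m - x'))\<^sup>2 = l * (norm (m - x))\<^sup>2 + inner (x' - x) ((2 * l) *\<^sub>R (x - m)) + l * (norm (x' - x))\<^sup>2"
    by (simp add: distrib_left)
  then show ?thesis using env_plus_le[OF q, of x' m] env_plus_eq[OF m] by linarith
qed

text \<open>The lower model is \<open>env_plus_upper\<close> with x and x' exchanged;
  \<open>is_prox_lipschitz\<close> moves its slope from x' back to x, which raises the constant to 3
  l.\<close>

lemma GDERIV_env_plus:
  assumes q: "continuous_on Y q" and m: "is_prox q x m"
  shows "GDERIV (env_plus q) x :> (2 * l) *\<^sub>R (x - m)"
proof (rule GDERIV_if_quadratic_remainder)
  fix x'
  obtain m' where m': "is_prox q x' m'" using is_prox_exists[OF q] by blast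
  have "env_plus q x \<le> env_plus q x' + inner (x - x') ((2 * l) *\<^sub>R (x' - m')) + l * (norm (x - x'))\<^sup>2"
    by (rule env_plus_upper[OF q m'])
  moreover have "inner (x - x') ((2 * l) *\<^sub>R (x' - m'))
      = 2 * l * inner (x' - x) (m' - m) - inner (x' - x) ((2 * l) *\<^sub>R (x - m)) - 2 * l * (norm (x' - x))\<^sup>2"
    unfolding power2_norm_eq_inner by (simp add: algebra_simps inner_commute)
  moreover have "2 * l * inner (x' - x) (m' - m) \<le> 2 * l * (norm (x' - x) * (2 * norm (x' - x)))"
    using l_pos is_prox_lipschitz[OF m m'] order_trans[OF norm_cauchy_schwarz mult_left_mono]
    by (intro mult_left_mono) auto
  ultimately have "env_plus q x' - env_plus q x - inner (x' - x) ((2 * l) *\<^sub>R (x - m)) \<ge> - (3 * l) * (norm (x' - x))\<^sup>2"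
    by (simp add: norm_minus_commute power2_eq_square algebra_simps)
  moreover have "l * (norm (x' - x))\<^sup>2 \<le> 3 * l * (norm (x' - x))\<^sup>2"
    using l_pos by (intro mult_right_mono) auto
  ultimately show "\<bar>env_plus q x' - env_plus q x - inner (x' - x) ((2 * l) *\<^sub>R (x - m))\<bar> \<le> 3 * l * (norm (x' - x))\<^sup>2"
    using env_plus_upper[OF q m, of x'] by (simp add: abs_le_iff)
qed

lemma grad_env_plus:
  assumes "continuous_on Y q" "is_prox q x m"
  shows "grad (env_plus q) x = (2 * l) *\<^sub>R (x - m)"
  by (rule grad_eqI[OF GDERIV_env_plus[OF assms]])

text \<open>Continuity makes the gradient at a random iterate measurable. The constant is 2 l (1 +
  2), with the 2 from \<open>is_prox_lipschitz\<close>.\<close>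

lemma continuous_grad_env_plus:
  assumes q: "continuous_on Y q"
  shows "continuous_on UNIV (grad (env_plus q))"
proof (rule lipschitz_on_continuous_on[where L = "6 * l"], rule lipschitz_onI)
  fix x x' :: 'a
  obtain m m' where m: "is_prox q x m" and m': "is_prox q x' m'" using is_prox_exists[OF q] by metis
  have "norm ((x - x') + (m' - m)) \<le> norm (x - x') + 2 * norm (x' - x)"
    using is_prox_lipschitz[OF m m'] norm_triangle_ineq[of "x - x'" "m' - m"] by linarith
  then have "norm ((x - m) - (x' - m')) \<le> 3 * norm (x - x')"
    by (simp add: algebra_simps norm_minus_commute)
  then have "2 * l * norm ((x - m) - (x' - m')) \<le> 2 * l * (3 * norm (x - x'))"
    using l_pos by (intro mult_left_mono) auto
  moreover have "norm ((2 * l) *\<^sub>R (x - m) - (2 * l) *\<^sub>R (x' - m')) = 2 * l * norm ((x - m) - (x' - m'))"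
    using l_pos by (simp flip: scaleR_diff_right)
  ultimately show "dist (grad (env_plus q) x) (grad (env_plus q) x') \<le> 6 * l * dist x x'"
    unfolding grad_env_plus[OF q m] grad_env_plus[OF q m'] dist_norm by simp
qed (use l_pos in auto)

text \<open>Passing from x to its proximal point m lowers the envelope by at least l |m - x|^2,
  which therefore cannot exceed the gap to a lower bound. A small gap thus controls the gradient at
  a single point, without averaging.\<close>

lemma norm_grad_env_plus_sq_le:
  assumes q: "continuous_on Y q" and bdd: "\<And>x'. c \<le> env_plus q x'"
  shows "(norm (grad (env_plus q) x))\<^sup>2 \<le> 4 * l * (env_plus q x - c)"
proof -
  obtain m where m: "is_prox q x m" using is_prox_exists[OF q] by blast
  have "l * (norm (m - x))\<^sup>2 \<le> env_plus q x - c"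
    using env_plus_le[OF q, of m m] env_plus_eq[OF m] bdd[of m] by simp
  then have "4 * l * (l * (norm (m - x))\<^sup>2) \<le> 4 * l * (env_plus q x - c)"
    using l_pos by (intro mult_left_mono) auto
  moreover have "(norm ((2 * l) *\<^sub>R (x - m)))\<^sup>2 = 4 * l * (l * (norm (m - x))\<^sup>2)"
    by (simp add: norm_minus_commute[of x m] power_mult_distrib) (simp add: power2_eq_square)
  ultimately show ?thesis unfolding grad_env_plus[OF q m] by simp
qed

end

section \<open>The saddle potential\<close>

lemma inner_le_young:
  fixes a c :: "'a::real_inner"
  assumes "0 \<le> s"
  shows "2 * s * inner a c \<le> 2 * s\<^sup>2 * (norm a)\<^sup>2 + 1 / 2 * (norm c)\<^sup>2"
proof -
  have "0 \<le> (norm ((2 * s) *\<^sub>R a - c))\<^sup>2" by simp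
  also have "\<dots> = 4 * s\<^sup>2 * (norm a)\<^sup>2 - 4 * s * inner a c + (norm c)\<^sup>2"
    unfolding power2_norm_eq_inner by (simp add: algebra_simps inner_commute power2_eq_square)
  finally show ?thesis by simp
qed

lemma norm_add_sq_le: "(norm (a + c))\<^sup>2 \<le> 2 * (norm a)\<^sup>2 + 2 * (norm c)\<^sup>2"
  for a c :: "'a::real_inner"
  using zero_le_power2[of "norm (a - c)"]
  unfolding power2_norm_eq_inner by (simp add: algebra_simps inner_commute)

context nonconvex_concave
begin

section \<open>Size and continuity of the penalty and the potential\<close>

text \<open>Completing the square gives l b (2 |y - y0|^2 - |v - (2 y0 - y)|^2): in v this is a
  concave proximal term centred at the reflection of y in y0.\<close>

definition penalty :: "real \<Rightarrow> 'b \<Rightarrow> 'b \<Rightarrow> 'b \<Rightarrow> real" where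
  "penalty b y0 y v = l * b * ((norm (v - y))\<^sup>2 - 2 * (norm (v - y0))\<^sup>2)"

definition potential :: "real \<Rightarrow> 'b \<Rightarrow> 'a \<Rightarrow> 'b \<Rightarrow> real" where
  "potential b y0 x y = env_plus (penalty b y0 y) x"

lemma continuous_penalty: "continuous_on S (penalty b y0 y)"
  unfolding penalty_def by (intro continuous_intros)

lemma norm_diff_sq_Y: "u \<in> Y \<Longrightarrow> v \<in> Y \<Longrightarrow> (norm (u - v))\<^sup>2 \<le> D\<^sup>2"
  using norm_diff_Y by (simp add: power_mono)

lemma penalty_le:
  assumes "0 \<le> b" "y \<in> Y" "v \<in> Y"
  shows "penalty b y0 y v \<le> l * b * D\<^sup>2"
proof -
  have "(norm (v - y))\<^sup>2 - 2 * (norm (v - y0))\<^sup>2 \<le> D\<^sup>2"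
    using norm_diff_sq_Y[OF assms(3,2)] zero_le_power2[of "norm (v - y0)"] by linarith
  then show ?thesis
    unfolding penalty_def using assms l_pos by (intro mult_left_mono) auto
qed

lemma penalty_ge:
  assumes "0 \<le> b" "y0 \<in> Y" "v \<in> Y"
  shows "0 \<le> penalty b y0 y v + 2 * (l * b * D\<^sup>2)"
proof -
  have "0 \<le> (norm (v - y))\<^sup>2 - 2 * (norm (v - y0))\<^sup>2 + 2 * D\<^sup>2"
    using norm_diff_sq_Y[OF assms(3,2)] zero_le_power2[of "norm (v - y)"] by linarith
  then have "0 \<le> l * b * ((norm (v - y))\<^sup>2 - 2 * (norm (v - y0))\<^sup>2 + 2 * D\<^sup>2)"
    using assms l_pos by simp
  then show ?thesis unfolding penalty_def by (simp add: algebra_simps)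
qed

lemma env_le_potential:
  assumes "0 \<le> b" "y0 \<in> Y"
  shows "env_plus (\<lambda>_. 0) x \<le> potential b y0 x y + 2 * (l * b * D\<^sup>2)"
  unfolding potential_def using penalty_ge[OF assms, of _ y]
  by (intro env_plus_mono continuous_penalty continuous_on_const) auto

text \<open>At y = y0 the two squares combine to -|v - y0|^2, so the starting value carries no extra
  l b D^2.\<close>

lemma potential_start_le:
  assumes "0 \<le> b"
  shows "potential b y0 x y0 \<le> env_plus (\<lambda>_. 0) x"
  using env_plus_mono[OF continuous_penalty continuous_on_const, of b y0 y0 0 0 x] assms l_pos
  unfolding potential_def by (simp add: penalty_def)

lemma penalty_diff_le:
  assumes "0 \<le> b" "y \<in> Y" "y' \<in> Y" "v \<in> Y"
  shows "penalty b y0 y v \<le> penalty b y0 y' v + 2 * l * b * D * norm (y - y')"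
proof -
  have "(norm (v - y))\<^sup>2 - (norm (v - y'))\<^sup>2 = (norm (v - y) + norm (v - y')) * (norm (v - y) - norm (v - y'))"
    by (simp add: power2_eq_square algebra_simps)
  also have "\<dots> \<le> (norm (v - y) + norm (v - y')) * norm (y - y')"
    using norm_triangle_ineq3[of "v - y" "v - y'"] by (intro mult_left_mono) (auto simp: norm_minus_commute)
  also have "\<dots> \<le> (D + D) * norm (y - y')"
    using assms norm_diff_Y by (intro mult_right_mono add_mono) auto
  finally have "l * b * ((norm (v - y))\<^sup>2 - (norm (v - y'))\<^sup>2) \<le> l * b * ((D + D) * norm (y - y'))"
    using assms l_pos by (intro mult_left_mono) auto
  then show ?thesis unfolding penalty_def by (simp add: algebra_simps)
qed

text \<open>The purpose is measurability. The projection extends the potential from Y to the whole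
  space; inside Y distances are at most D, which makes the difference of squares in the penalty
  Lipschitz.\<close>

lemma continuous_potential:
  assumes "0 \<le> b"
  shows "continuous_on UNIV (\<lambda>z. potential b y0 (fst z) (closest_point Y (snd z)))"
proof -
  let ?U = "\<lambda>z. potential b y0 (fst z) (closest_point Y (snd z))"
  let ?K = "L + 2 * l * b * D"
  have le: "?U z \<le> ?U z' + ?K * dist z z'" for z z'
  proof -
    let ?y = "closest_point Y (snd z)" and ?y' = "closest_point Y (snd z')"
    have Y: "?y \<in> Y" "?y' \<in> Y" using closest_point_in_set[OF closed_Y Y_nonempty] by auto
    have "?U z \<le> env_plus (penalty b y0 ?y') (fst z) + 2 * l * b * D * norm (?y - ?y')"
      unfolding potential_def using penalty_diff_le[OF assms Y]
      by (intro env_plus_mono continuous_penalty) auto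
    also have "env_plus (penalty b y0 ?y') (fst z) \<le> ?U z' + L * norm (fst z - fst z')"
      unfolding potential_def by (intro env_plus_lipschitz continuous_penalty)
    also have "L * norm (fst z - fst z') \<le> L * dist z z'"
      using L_nonneg dist_fst_le[of z z'] by (intro mult_left_mono) (auto simp: dist_norm)
    also have "2 * l * b * D * norm (?y - ?y') \<le> 2 * l * b * D * dist z z'"
      using l_pos assms D_nonneg closest_point_lipschitz[OF convex_Y closed_Y Y_nonempty, of "snd z" "snd z'"]
        dist_snd_le[of z z'] by (intro mult_left_mono) (auto simp: dist_norm)
    finally show ?thesis by (simp add: algebra_simps)
  qed
  have "?K-lipschitz_on UNIV ?U"
  proof (rule lipschitz_onI)
    show "dist (?U z) (?U z') \<le> ?K * dist z z'" for z z'
      using le[of z z'] le[of z' z] by (simp add: dist_real_def abs_le_iff dist_commute)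
    show "0 \<le> ?K" using l_pos assms D_nonneg L_nonneg by simp
  qed
  then show ?thesis by (rule lipschitz_on_continuous_on)
qed

section \<open>The penalised maximiser and the saddle point\<close>

lemma penalty_segment:
  "penalty b y0 y ((1 - t) *\<^sub>R v + t *\<^sub>R v')
   = (1 - t) * penalty b y0 y v + t * penalty b y0 y v' + l * b * (t * (1 - t)) * (norm (v' - v))\<^sup>2"
  unfolding penalty_def norm_segment_sq norm_minus_commute[of v' v] by (simp add: algebra_simps)

text \<open>The weights 1 and -2 of the two squares leave concavity of modulus l b, exact by
  \<open>penalty_segment\<close>; moving from v a fraction t towards v' turns it into growth around
  v.\<close>

lemma penalised_max_gap:
  assumes v: "v \<in> Y" "\<And>v'. v' \<in> Y \<Longrightarrow> f (w, v') + penalty b y0 y v' \<le> f (w, v) + penalty b y0 y v"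
    and v': "v' \<in> Y"
  shows "f (w, v') + penalty b y0 y v' + l * b * (norm (v' - v))\<^sup>2 \<le> f (w, v) + penalty b y0 y v"
proof (rule le_if_le_add_small_mult)
  fix t :: real assume t: "0 < t" "t \<le> 1"
  let ?c = "(1 - t) *\<^sub>R v + t *\<^sub>R v'" and ?N = "l * b * (norm (v' - v))\<^sup>2"
  have "?c \<in> Y" using convexD[OF convex_Y v(1) v', of "1 - t" t] t by simp
  then have "f (w, ?c) + penalty b y0 y ?c \<le> f (w, v) + penalty b y0 y v" by (rule v(2))
  moreover have "(1 - t) * f (w, v) + t * f (w, v') \<le> f (w, ?c)"
    using t by (intro concave_segment) auto
  moreover have "l * b * (t * (1 - t)) * (norm (v' - v))\<^sup>2 = t * (1 - t) * ?N" by simp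
  ultimately have "t * (f (w, v') + penalty b y0 y v' + ?N) \<le> t * (f (w, v) + penalty b y0 y v + ?N * t)"
    unfolding penalty_segment by (simp add: algebra_simps)
  then show "f (w, v') + penalty b y0 y v' + ?N \<le> f (w, v) + penalty b y0 y v + ?N * t"
    using t by (simp add: mult_le_cancel_left_pos)
qed

lemma norm_gx_diff_le: "norm (gx w v' - gx w v) \<le> l * norm (v' - v)"
proof -
  have "norm (fst (grad f (w, v') - grad f (w, v))) \<le> norm (grad f (w, v') - grad f (w, v))"
    by (metis norm_fst_le prod.collapse)
  also have "\<dots> \<le> l * norm ((w, v') - (w, v))" by (rule smooth_fun_lipschitz_grad[OF smooth])
  finally show ?thesis by (simp add: norm_Pair)
qed

text \<open>Danskin's theorem at the proximal point, without differentiating the maximum. Minimality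
  of m is tested by a step -t g, where g is the vector claimed to vanish; strong concavity keeps the
  maximiser within O(t) of v, so the first-order gain t |g|^2 is at most O(t^2).\<close>

lemma penalised_saddle_stationary:
  assumes b: "0 < b" and m: "is_prox (penalty b y0 y) x m"
    and v: "v \<in> Y" "\<And>v'. v' \<in> Y \<Longrightarrow> f (m, v') + penalty b y0 y v' \<le> f (m, v) + penalty b y0 y v"
  shows "gx m v = (2 * l) *\<^sub>R (x - m)"
proof -
  obtain q where q: "q = penalty b y0 y" by blast
  have cq: "continuous_on Y q" unfolding q by (rule continuous_penalty)
  obtain g where g: "g = gx m v + (2 * l) *\<^sub>R (m - x)" by blast
  have "(norm g)\<^sup>2 \<le> 0"
  proof (rule le_if_le_add_small_mult)
    fix t :: real assume t: "0 < t" "t \<le> 1"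
    obtain w where w: "w = m - t *\<^sub>R g" by blast
    obtain v' where v': "v' \<in> Y" "max_plus q w = f (w, v') + q v'"
      and v'_max: "\<And>u. u \<in> Y \<Longrightarrow> f (w, u) + q u \<le> f (w, v') + q v'"
      using max_plus_attained[OF cq] by metis
    have nw: "norm (w - m) = t * norm g" using t unfolding w by simp
    \<comment> \<open>Growth at m and maximality of v' at w differ by a mixed difference of f only.
      The left side is quadratic in |v' - v| and the right side linear, hence |v' - v| <= |w - m| /
      b.\<close>
    have "l * b * (norm (v' - v))\<^sup>2 \<le> l * norm (w - m) * norm (v' - v)"
      using penalised_max_gap[OF v v'(1)] v'_max[OF v(1)]
        smooth_fun_mixed_difference[OF smooth, of w v' v m] unfolding q by linarith
    then have dv: "norm (v' - v) \<le> t * norm g / b"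
      using l_pos b unfolding nw
      by (cases "norm (v' - v) = 0") (auto simp: power2_eq_square field_simps t less_imp_le)
    have "max_plus q m = f (m, v) + q v"
      using max_plus_attained[OF cq, of m] v unfolding q by (metis order_antisym)
    then have "f (m, v) + q v + l * (norm (m - x))\<^sup>2 \<le> f (w, v') + q v' + l * (norm (w - x))\<^sup>2"
      using is_prox_le[OF m, of w] v'(2) unfolding q by simp
    moreover have "f (w, v') \<le> f (m, v') + inner (w - m) (gx m v') + l / 2 * (norm (w - m))\<^sup>2"
      by (rule f_upper_x)
    moreover have "f (m, v') + q v' \<le> f (m, v) + q v" unfolding q by (rule v(2)[OF v'(1)])
    ultimately have 1: "l * (norm (m - x))\<^sup>2
      \<le> inner (w - m) (gx m v') + l / 2 * (norm (w - m))\<^sup>2 + l * (norm (w - x))\<^sup>2" by linarith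
    have "norm (gx m v' - gx m v) \<le> l * (t * norm g / b)"
      using norm_gx_diff_le[of m v' v] mult_left_mono[OF dv, of l] l_pos by linarith
    have "inner (w - m) (gx m v' - gx m v) \<le> norm (w - m) * norm (gx m v' - gx m v)"
      by (rule norm_cauchy_schwarz)
    also have "\<dots> \<le> (t * norm g) * (l * (t * norm g / b))"
      unfolding nw using t \<open>norm (gx m v' - gx m v) \<le> _\<close> by (intro mult_left_mono) auto
    finally have 2: "inner (w - m) (gx m v') \<le> - (t * inner g (gx m v)) + t * (l / b * (norm g)\<^sup>2 * t)"
      by (simp add: inner_diff_right w power2_eq_square mult_ac)
    have 3: "(norm (w - x))\<^sup>2 = (norm (m - x))\<^sup>2 - 2 * t * inner g (m - x) + t * ((norm g)\<^sup>2 * t)"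
      unfolding w power2_norm_eq_inner by (simp add: algebra_simps inner_commute)
    have 4: "(norm g)\<^sup>2 = inner g (gx m v) + 2 * l * inner g (m - x)"
      unfolding power2_norm_eq_inner by (subst (2) g) (simp add: inner_add_right)
    have "t * (norm g)\<^sup>2 \<le> t * (0 + (l / b + l / 2 + l) * (norm g)\<^sup>2 * t)"
      using 1 2 unfolding 3 nw 4[THEN arg_cong[where f = "(*) t"], simplified distrib_left]
      by (simp add: algebra_simps power2_eq_square)
    then show "(norm g)\<^sup>2 \<le> 0 + (l / b + l / 2 + l) * (norm g)\<^sup>2 * t" using t by simp
  qed
  then have "g = 0" by simp
  then show ?thesis unfolding g by (simp add: algebra_simps add_eq_0_iff)
qed

text \<open>The penalty shifts the maximum by at most l b D^2 upwards and 2 l b D^2 downwards, so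
  the unpenalised growth l / 2 |w - m|^2 is at most 3 l b D^2. This gives 12 b D^2 in |x - m|^2 and
  48 after the factor 4 l^2.\<close>

lemma norm_grad_env_sq_le_penalised:
  assumes b: "0 \<le> b" and y: "y \<in> Y" "y0 \<in> Y" and w: "is_prox (penalty b y0 y) x w"
  shows "(norm (grad (env_plus (\<lambda>_. 0)) x))\<^sup>2 \<le> 8 * l\<^sup>2 * (norm (x - w))\<^sup>2 + 48 * l\<^sup>2 * b * D\<^sup>2"
proof -
  have c0: "continuous_on Y (\<lambda>_. 0 :: real)" by simp
  obtain m where m: "is_prox (\<lambda>_. 0) x m" using is_prox_exists[OF c0] by blast
  have "max_plus (\<lambda>_. 0) m + l * (norm (m - x))\<^sup>2 + l / 2 * (norm (w - m))\<^sup>2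
      \<le> max_plus (\<lambda>_. 0) w + l * (norm (w - x))\<^sup>2" using m unfolding is_prox_def by blast
  moreover have "max_plus (\<lambda>_. 0) w \<le> max_plus (penalty b y0 y) w + 2 * (l * b * D\<^sup>2)"
    using penalty_ge[OF b y(2), of _ y] by (intro max_plus_mono continuous_penalty c0) auto
  moreover have "max_plus (penalty b y0 y) m \<le> max_plus (\<lambda>_. 0) m + l * b * D\<^sup>2"
    using penalty_le[OF b y(1)] by (intro max_plus_mono continuous_penalty c0) auto
  ultimately have "l * (norm (w - m))\<^sup>2 \<le> l * (6 * b * D\<^sup>2)" using is_prox_le[OF w, of m] by simp
  then have "(norm (w - m))\<^sup>2 \<le> 6 * b * D\<^sup>2" using l_pos by simp
  then have "(norm (x - m))\<^sup>2 \<le> 2 * (norm (x - w))\<^sup>2 + 12 * b * D\<^sup>2"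
    using norm_add_sq_le[of "x - w" "w - m"] by simp
  then have "4 * l\<^sup>2 * (norm (x - m))\<^sup>2 \<le> 4 * l\<^sup>2 * (2 * (norm (x - w))\<^sup>2 + 12 * b * D\<^sup>2)"
    by (intro mult_left_mono) auto
  moreover have "(norm ((2 * l) *\<^sub>R (x - m)))\<^sup>2 = 4 * l\<^sup>2 * (norm (x - m))\<^sup>2"
    unfolding norm_scaleR power_mult_distrib by simp
  ultimately show ?thesis unfolding grad_env_plus[OF c0 m] by (simp add: distrib_left)
qed

section \<open>Decrease of the potential in one step\<close>

text \<open>The old w is reused as a competitor in the new minimum, and v' is the new best response
  to it. The noise meets linearly only the saddle point (w, v) of the old state.\<close>

lemma potential_step:
  assumes pos: "0 < b" "0 < \<eta>y" and \<eta>x: "\<eta>x = b * \<eta>y" and small: "12 * (l * \<eta>y) \<le> 1"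
    and y: "y \<in> Y" "y0 \<in> Y"
    and w: "is_prox (penalty b y0 y) x w"
    and v: "v \<in> Y" "\<And>u. u \<in> Y \<Longrightarrow> f (w, u) + penalty b y0 y u \<le> f (w, v) + penalty b y0 y v"
    and x': "x' = x - \<eta>x *\<^sub>R (gx x y + dx)"
    and y': "y' = closest_point Y (y + \<eta>y *\<^sub>R (gy x y + dy))"
  shows "potential b y0 x' y' \<le> potential b y0 x y
       + 2 * l * \<eta>x * (inner dx (w - x) + inner dy (y - v))
       + l * \<eta>x\<^sup>2 * (norm (gx x y + dx))\<^sup>2 + 4 * l * \<eta>x * \<eta>y * (norm dy)\<^sup>2
       - l\<^sup>2 * \<eta>x * (norm (x - w))\<^sup>2 + 6 * l\<^sup>2 * \<eta>x * b * D\<^sup>2"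
proof -
  have \<eta>x_pos: "0 < \<eta>x" and lb: "0 < l * b" using pos l_pos \<eta>x by auto
  have y'Y: "y' \<in> Y" unfolding y' by (rule closest_point_in_set[OF closed_Y Y_nonempty])
  obtain v' where v': "v' \<in> Y" "max_plus (penalty b y0 y') w = f (w, v') + penalty b y0 y' v'"
    and v'_max: "\<And>u. u \<in> Y \<Longrightarrow> f (w, u) + penalty b y0 y' u \<le> f (w, v') + penalty b y0 y' v'"
    using max_plus_attained[OF continuous_penalty] by metis
  let ?A = "norm (x - w)" and ?B = "norm (y' - y)" and ?C = "norm (v' - v)"
  have up: "potential b y0 x' y' \<le> f (w, v') + penalty b y0 y' v' + l * (norm (w - x'))\<^sup>2"
    using env_plus_le[OF continuous_penalty, of b y0 y' x' w] v'(2) unfolding potential_def by simp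
  have "max_plus (penalty b y0 y) w = f (w, v) + penalty b y0 y v"
    using max_plus_attained[OF continuous_penalty, of b y0 y w] v by (metis order_antisym)
  then have "potential b y0 x y = f (w, v) + penalty b y0 y v + l * (norm (w - x))\<^sup>2"
    using env_plus_eq[OF w] unfolding potential_def by simp
  \<comment> \<open>As a candidate in the old maximum, v' loses to v by l b |v' - v|^2; this reserve
    pays for every later occurrence of |v' - v|^2.\<close>
  then have low: "f (w, v') + penalty b y0 y v' + l * b * ?C\<^sup>2 + l * (norm (w - x))\<^sup>2 \<le> potential b y0 x y"
    using penalised_max_gap[OF v v'(1)] by simp

  \<comment> \<open>Obtuse angle property of the projection, tested at v' in Y: the residual
    contributes a nonpositive term to |v' - y'|^2.\<close>
  have "inner (y + \<eta>y *\<^sub>R (gy x y + dy) - y') (v' - y') \<le> 0"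
    unfolding y' by (rule closest_point_dot[OF convex_Y closed_Y v'(1)])
  moreover have "(norm (v' - y'))\<^sup>2 - (norm (v' - y))\<^sup>2
    = - ?B\<^sup>2 + 2 * inner (y + \<eta>y *\<^sub>R (gy x y + dy) - y') (v' - y') + 2 * \<eta>y * inner (gy x y) (y' - v') + 2 * \<eta>y * inner dy (y' - v')"
    unfolding power2_norm_eq_inner by (simp add: algebra_simps inner_commute)
  ultimately have "(norm (v' - y'))\<^sup>2 - (norm (v' - y))\<^sup>2
    \<le> - ?B\<^sup>2 + 2 * \<eta>y * inner (gy x y) (y' - v') + 2 * \<eta>y * inner dy (y' - v')" by linarith
  also have "2 * \<eta>y * inner (gy x y) (y' - v') \<le> 2 * \<eta>y * (f (x, y') - f (x, v') + l / 2 * ?B\<^sup>2)"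
  proof (intro mult_left_mono)
    have "inner (gy x y) (y' - v') = inner (y' - y) (gy x y) - inner (v' - y) (gy x y)"
      by (simp add: algebra_simps inner_commute)
    then show "inner (gy x y) (y' - v') \<le> f (x, y') - f (x, v') + l / 2 * ?B\<^sup>2"
      using f_concave_y[of x v' y] f_lower_y[of x y y'] by linarith
  qed (use pos in simp)
  \<comment> \<open>Of the three parts only y - v is fixed before the noise and stays linear;
    Young's inequality sends the other two to half of |y' - y|^2 and half of |v' - v|^2.\<close>
  also have "2 * \<eta>y * inner dy (y' - v')
    = 2 * \<eta>y * inner dy (y - v) + 2 * \<eta>y * inner dy (y' - y) + 2 * \<eta>y * inner dy (v - v')"
    by (simp add: algebra_simps)
  also have "2 * \<eta>y * inner dy (y' - y) \<le> 2 * \<eta>y\<^sup>2 * (norm dy)\<^sup>2 + 1 / 2 * ?B\<^sup>2"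
    using pos by (intro inner_le_young) simp
  also have "2 * \<eta>y * inner dy (v - v') \<le> 2 * \<eta>y\<^sup>2 * (norm dy)\<^sup>2 + 1 / 2 * ?C\<^sup>2"
    using inner_le_young[of \<eta>y dy "v - v'"] pos by (simp add: norm_minus_commute)
  finally have "l * b * ((norm (v' - y'))\<^sup>2 - (norm (v' - y))\<^sup>2)
    \<le> l * b * (- ?B\<^sup>2 + 2 * \<eta>y * (f (x, y') - f (x, v') + l / 2 * ?B\<^sup>2)
      + (2 * \<eta>y * inner dy (y - v) + (2 * \<eta>y\<^sup>2 * (norm dy)\<^sup>2 + 1 / 2 * ?B\<^sup>2) + (2 * \<eta>y\<^sup>2 * (norm dy)\<^sup>2 + 1 / 2 * ?C\<^sup>2)))"
    using lb by (intro mult_left_mono) auto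
  moreover have "penalty b y0 y' v' - penalty b y0 y v' = l * b * ((norm (v' - y'))\<^sup>2 - (norm (v' - y))\<^sup>2)"
    unfolding penalty_def by (simp add: algebra_simps)
  ultimately have E1: "penalty b y0 y' v' - penalty b y0 y v'
    \<le> - l * b * ?B\<^sup>2 / 2 + l * b * ?C\<^sup>2 / 2 + 2 * l * \<eta>x * (f (x, y') - f (x, v')) + l * b * (l * \<eta>y * ?B\<^sup>2)
      + 2 * l * \<eta>x * inner dy (y - v) + 4 * l * \<eta>x * \<eta>y * (norm dy)\<^sup>2"
    unfolding \<eta>x by (simp add: algebra_simps power2_eq_square)

  have "(norm (w - x'))\<^sup>2 - (norm (w - x))\<^sup>2
    = 2 * \<eta>x * (inner (w - x) (gx x y) + inner dx (w - x)) + \<eta>x\<^sup>2 * (norm (gx x y + dx))\<^sup>2"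
    unfolding x' power2_norm_eq_inner by (simp add: algebra_simps inner_commute power2_eq_square)
  moreover have "2 * \<eta>x * inner (w - x) (gx x y) \<le> 2 * \<eta>x * (f (w, y) - f (x, y) + l / 2 * ?A\<^sup>2)"
    using f_lower_x[of x y w] \<eta>x_pos by (intro mult_left_mono) (auto simp: norm_minus_commute)
  ultimately have "(norm (w - x'))\<^sup>2 - (norm (w - x))\<^sup>2
    \<le> 2 * \<eta>x * (f (w, y) - f (x, y) + l / 2 * ?A\<^sup>2) + 2 * \<eta>x * inner dx (w - x) + \<eta>x\<^sup>2 * (norm (gx x y + dx))\<^sup>2"
    by (simp add: distrib_left)
  then have E2: "l * (norm (w - x'))\<^sup>2 - l * (norm (w - x))\<^sup>2
    \<le> 2 * l * \<eta>x * (f (w, y) - f (x, y)) + l\<^sup>2 * \<eta>x * ?A\<^sup>2 + 2 * l * \<eta>x * inner dx (w - x) + l * \<eta>x\<^sup>2 * (norm (gx x y + dx))\<^sup>2"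
    using mult_left_mono[of _ _ l] l_pos by (fastforce simp: algebra_simps power2_eq_square)

  \<comment> \<open>y' is itself a candidate in the new maximum; the lower and upper bounds of the
    penalty, 2 and 1 times l b D^2, make up the 3.\<close>
  have "f (w, y') + penalty b y0 y' y' \<le> f (w, v') + penalty b y0 y' v'" by (rule v'_max[OF y'Y])
  then have a1: "f (w, y') \<le> f (w, v') + 3 * (l * b * D\<^sup>2)"
    using penalty_ge[of b y0 y' y'] penalty_le[of b y' v' y0] pos y y'Y v'(1) by simp
  have a2: "f (x, y') - f (x, y) - (f (w, y') - f (w, y)) \<le> l * ?A * ?B"
    by (rule smooth_fun_mixed_difference[OF smooth])
  have a3: "f (w, v') + inner (x - w) (gx w v') - l / 2 * ?A\<^sup>2 \<le> f (x, v')"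
    by (rule f_lower_x)
  have "inner (x - w) (gx w v - gx w v') \<le> ?A * norm (gx w v - gx w v')" by (rule norm_cauchy_schwarz)
  also have "\<dots> \<le> ?A * (l * ?C)"
    using norm_gx_diff_le[of w v' v] by (intro mult_left_mono) (auto simp: norm_minus_commute)
  finally have "inner (x - w) (gx w v') \<ge> inner (x - w) (gx w v) - l * ?A * ?C"
    by (simp add: inner_diff_right algebra_simps)
  moreover have "inner (x - w) (gx w v) = 2 * l * ?A\<^sup>2"
    using arg_cong[OF penalised_saddle_stationary[OF pos(1) w v], of "inner (x - w)"]
    by (simp add: power2_norm_eq_inner)
  ultimately have "f (x, y') - f (x, v') + (f (w, y) - f (x, y))
    \<le> l * ?A * ?B + l * ?A * ?C + 3 * (l * b * D\<^sup>2) - 3 / 2 * l * ?A\<^sup>2"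
    using a1 a2 a3 by (simp add: field_simps)
  then have "2 * l * \<eta>x * (f (x, y') - f (x, v') + (f (w, y) - f (x, y)))
    \<le> 2 * l * \<eta>x * (l * ?A * ?B + l * ?A * ?C + 3 * (l * b * D\<^sup>2) - 3 / 2 * l * ?A\<^sup>2)"
    using l_pos \<eta>x_pos by (intro mult_left_mono) auto
  then have E3: "2 * l * \<eta>x * (f (x, y') - f (x, v')) + 2 * l * \<eta>x * (f (w, y) - f (x, y))
    \<le> 2 * l * \<eta>x * (l * ?A * ?B) + 2 * l * \<eta>x * (l * ?A * ?C) + 6 * l\<^sup>2 * \<eta>x * b * D\<^sup>2 - 3 * l\<^sup>2 * \<eta>x * ?A\<^sup>2"
    by (simp add: algebra_simps power2_eq_square)

  \<comment> \<open>Since \<eta>x = b \<eta>y, the cross term is l b times 2 l \<eta>y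
    \<open>?A\<close> r, so a quarter of l b r^2 suffices against a small multiple of l^2 \<eta>x
    \<open>?A\<close>^2.\<close>
  have young: "2 * l * \<eta>x * (l * ?A * r) \<le> l * b * r\<^sup>2 / 4 + l\<^sup>2 * \<eta>x * ?A\<^sup>2 * (4 * (l * \<eta>y))" for r
  proof -
    have "0 \<le> (r / 2 - 2 * l * \<eta>y * ?A)\<^sup>2" by simp
    then have "2 * l * \<eta>y * ?A * r \<le> r\<^sup>2 / 4 + 4 * (l * \<eta>y * ?A)\<^sup>2"
      by (simp add: power2_eq_square algebra_simps)
    then have "l * b * (2 * l * \<eta>y * ?A * r) \<le> l * b * (r\<^sup>2 / 4 + 4 * (l * \<eta>y * ?A)\<^sup>2)"
      using lb by (intro mult_left_mono) auto
    then show ?thesis unfolding \<eta>x by (simp add: algebra_simps power2_eq_square)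
  qed
  \<comment> \<open>With \<open>small\<close>, the coefficients of l b |y' - y|^2 sum to -1/2 + 1/12
    + 1/4, those of l b |v' - v|^2 to -1 + 1/2 + 1/4, and those of l^2 \<eta>x |x - w|^2 to 1 - 3 +
    2/3, which is below -1.\<close>
  have "l\<^sup>2 * \<eta>x * ?A\<^sup>2 * (4 * (l * \<eta>y)) \<le> l\<^sup>2 * \<eta>x * ?A\<^sup>2 * (1 / 3)"
    using small \<eta>x_pos by (intro mult_left_mono) auto
  moreover have "l * b * (l * \<eta>y * ?B\<^sup>2) \<le> l * b * (1 / 12 * ?B\<^sup>2)"
    using small lb by (intro mult_left_mono mult_right_mono) auto
  moreover have "0 \<le> l * b * ?C\<^sup>2" "0 \<le> l * b * ?B\<^sup>2" "0 \<le> l\<^sup>2 * \<eta>x * ?A\<^sup>2" using lb \<eta>x_pos by auto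
  ultimately show ?thesis
    using up low E1 E2 E3 young[of ?B] young[of ?C] unfolding distrib_left by linarith
qed

end

section \<open>The random iterates\<close>

text \<open>For nonnegative integrals Tonelli gives the average over the index without prior
  integrability; the finite result then yields it.\<close>

lemma random_output_stationaryI:
  assumes W: "prob_space W" and T: "1 \<le> T"
    and meas: "\<And>j. (\<lambda>\<omega>. grad (moreau_envelope (1 / (2 * l)) \<Phi>) (X j \<omega>)) \<in> borel_measurable W"
    and le: "(\<Sum>j = 1..T. \<integral>\<^sup>+\<omega>. ennreal ((norm (grad (moreau_envelope (1 / (2 * l)) \<Phi>) (X j \<omega>)))\<^sup>2) \<partial>W)
      \<le> ennreal (real T * \<epsilon>\<^sup>2)"
  shows "random_output_stationary W X T \<Phi> l \<epsilon>"
proof -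
  interpret W: prob_space W by fact
  let ?p = "measure_pmf (pmf_of_set {1..T})"
  let ?Q = "W \<Otimes>\<^sub>M ?p"
  let ?g = "\<lambda>j \<omega>. (norm (grad (moreau_envelope (1 / (2 * l)) \<Phi>) (X j \<omega>)))\<^sup>2"
  let ?h = "\<lambda>(\<omega>, j). ?g j \<omega>"
  have g: "?g j \<in> borel_measurable W" for j using meas[of j] by measurable
  \<comment> \<open>The index is discrete, so measurability on the product reduces to measurability
    for each fixed index.\<close>
  have "snd \<in> measurable ?Q (count_space UNIV)"
    using measurable_snd[of W ?p] by (simp cong: measurable_cong_sets)
  moreover have "(\<lambda>q. ?g j (fst q)) \<in> borel_measurable ?Q" for j
    by (rule measurable_compose[OF measurable_fst g])
  ultimately have "(\<lambda>q. ?g (snd q) (fst q)) \<in> borel_measurable ?Q"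
    by (rule measurable_compose_countable[rotated])
  then have h: "?h \<in> borel_measurable ?Q" by (simp add: case_prod_beta')
  have "(\<integral>\<^sup>+q. ennreal (?h q) \<partial>?Q) = (\<integral>\<^sup>+\<omega>. \<integral>\<^sup>+j. ennreal (?g j \<omega>) \<partial>?p \<partial>W)"
    using sigma_finite_measure.nn_integral_fst[OF _ measurable_compose[OF h measurable_ennreal]]
      prob_space_imp_sigma_finite[OF prob_space_measure_pmf] by (metis (no_types, lifting) case_prod_conv nn_integral_cong)
  also have "\<dots> = (\<integral>\<^sup>+\<omega>. (\<Sum>j = 1..T. ennreal (?g j \<omega>)) / of_nat T \<partial>W)"
    using T by (simp add: nn_integral_pmf_of_set ennreal_of_nat_eq_real_of_nat)
  also have "\<dots> = (\<Sum>j = 1..T. \<integral>\<^sup>+\<omega>. ennreal (?g j \<omega>) \<partial>W) / of_nat T"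
    using g by (simp add: nn_integral_divide nn_integral_sum del: sum_ennreal)
  also have "\<dots> \<le> ennreal (real T * \<epsilon>\<^sup>2) / of_nat T"
    using le by (rule divide_right_mono_ennreal)
  also have "\<dots> = ennreal (\<epsilon>\<^sup>2)"
    using T by (simp add: ennreal_of_nat_eq_real_of_nat divide_ennreal)
  finally have b: "(\<integral>\<^sup>+q. ennreal (?h q) \<partial>?Q) \<le> ennreal (\<epsilon>\<^sup>2)" .
  have "integrable ?Q ?h"
    using h le_less_trans[OF b ennreal_less_top] by (intro integrableI_nonneg) auto
  moreover have "(\<integral>q. ?h q \<partial>?Q) \<le> \<epsilon>\<^sup>2"
    using b h by (subst integral_eq_nn_integral) (auto intro!: enn2real_leI)
  ultimately show ?thesis by (simp add: random_output_stationary_def Let_def)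
qed

locale sgda_run = nonconvex_concave f Y l L D
  for f :: "'a::euclidean_space \<times> 'b::euclidean_space \<Rightarrow> real" and Y l L D +
  fixes P :: "'s measure" and G :: "'a \<times> 'b \<Rightarrow> 's \<Rightarrow> 'a \<times> 'b"
    and W :: "'w measure" and \<xi> :: "nat \<Rightarrow> nat \<Rightarrow> 'w \<Rightarrow> 's"
    and \<sigma> \<eta>x \<eta>y b :: real and x0 :: 'a and y0 :: 'b
  assumes gradient_oracle: "stochastic_gradient_oracle f P G \<sigma>"
    and iid: "iid_samples W P 1 \<xi>"
    and y0_Y: "y0 \<in> Y"
    and b_pos: "0 < b" and \<eta>y_pos: "0 < \<eta>y" and \<eta>x_eq: "\<eta>x = b * \<eta>y"
    and \<eta>y_small: "12 * (l * \<eta>y) \<le> 1"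
    and bdd_below_env: "bdd_below (range (env_plus (\<lambda>_. 0)))"
begin

abbreviation env :: "'a \<Rightarrow> real" where "env \<equiv> env_plus (\<lambda>_. 0)"

definition step :: "'a \<times> 'b \<Rightarrow> 's \<Rightarrow> 'a \<times> 'b" where
  "step z s = (fst z - \<eta>x *\<^sub>R fst (G z s), closest_point Y (snd z + \<eta>y *\<^sub>R snd (G z s)))"

text \<open>The sample space \<open>'v\<close> is left free: besides \<open>'w\<close>, the run is
  evaluated on the space of sample families, which expresses it as a function of past
  samples.\<close>

definition run :: "(nat \<Rightarrow> nat \<Rightarrow> 'v \<Rightarrow> 's) \<Rightarrow> nat \<Rightarrow> 'v \<Rightarrow> 'a \<times> 'b" where
  "run = sgda G Y \<eta>x \<eta>y 1 x0 y0"

abbreviation Z :: "nat \<Rightarrow> 'w \<Rightarrow> 'a \<times> 'b" where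
  "Z \<equiv> run \<xi>"

text \<open>The error of one step divided by \<eta>x. The 12 is 6 from \<open>potential_step\<close>
  plus 48 / 8 from replacing the proximal distance by the gradient of the envelope.\<close>

definition err :: real where
  "err = 2 * l * \<eta>x * L\<^sup>2 + (2 * l * \<eta>x + 4 * l * \<eta>y) * \<sigma>\<^sup>2 + 12 * l\<^sup>2 * b * D\<^sup>2"

text \<open>A lower bound of the potential; subtracting it gives a nonnegative quantity, fit for
  integrals in \<open>ennreal\<close>.\<close>

definition inf_pot :: real where
  "inf_pot = (INF x. env x) - 2 * (l * b * D\<^sup>2)"

sublocale P: prob_space P
  using gradient_oracle by (simp add: stochastic_gradient_oracle_def)

sublocale W: prob_space W
  using iid by (simp add: iid_samples_def)

lemma \<eta>x_pos: "0 < \<eta>x"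
  using b_pos \<eta>y_pos \<eta>x_eq by simp

lemma err_nonneg: "0 \<le> err"
  unfolding err_def using l_pos \<eta>x_pos \<eta>y_pos b_pos by simp

lemma run_0: "run \<zeta> 0 = (\<lambda>_. (x0, y0))"
  by (simp add: run_def fun_eq_iff)

lemma run_Suc: "run \<zeta> (Suc t) \<omega> = step (run \<zeta> t \<omega>) (\<zeta> (Suc t) (Suc 0) \<omega>)"
  by (simp add: run_def step_def Let_def)

lemma snd_step: "snd (step z s) \<in> Y"
  unfolding step_def using closest_point_in_set[OF closed_Y Y_nonempty] by simp

lemma snd_Z: "snd (Z t \<omega>) \<in> Y"
  using snd_step y0_Y by (cases t) (auto simp: run_0 run_Suc)

section \<open>Measurability and the Markov property\<close>

lemma measurable_step: "(\<lambda>(z, s). step z s) \<in> measurable (borel \<Otimes>\<^sub>M P) borel"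
proof -
  have G: "(\<lambda>(z, s). G z s) \<in> borel_measurable (borel \<Otimes>\<^sub>M P)"
    using gradient_oracle by (simp add: stochastic_gradient_oracle_def)
  have cf: "fst \<in> borel_measurable (borel :: ('a \<times> 'b) measure)" and cs: "snd \<in> borel_measurable (borel :: ('a \<times> 'b) measure)"
    by (auto intro!: borel_measurable_continuous_onI continuous_intros)
  have cp: "closest_point Y \<in> borel_measurable borel"
    by (intro borel_measurable_continuous_onI continuous_on_closest_point convex_Y closed_Y Y_nonempty)
  have 1: "(\<lambda>p. fst (fst p)) \<in> borel_measurable ((borel :: ('a \<times> 'b) measure) \<Otimes>\<^sub>M P)"
    and 2: "(\<lambda>p. snd (fst p)) \<in> borel_measurable ((borel :: ('a \<times> 'b) measure) \<Otimes>\<^sub>M P)"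
    by (rule measurable_compose[OF measurable_fst cf], rule measurable_compose[OF measurable_fst cs])
  have 3: "(\<lambda>p. fst (G (fst p) (snd p))) \<in> borel_measurable (borel \<Otimes>\<^sub>M P)"
    and 4: "(\<lambda>p. snd (G (fst p) (snd p))) \<in> borel_measurable (borel \<Otimes>\<^sub>M P)"
    using measurable_compose[OF G cf] measurable_compose[OF G cs] by (simp_all add: case_prod_beta')
  have "(\<lambda>p. fst (fst p) - \<eta>x *\<^sub>R fst (G (fst p) (snd p))) \<in> borel_measurable (borel \<Otimes>\<^sub>M P)"
    by (intro borel_measurable_diff borel_measurable_scaleR 1 3 borel_measurable_const)
  moreover have "(\<lambda>p. closest_point Y (snd (fst p) + \<eta>y *\<^sub>R snd (G (fst p) (snd p)))) \<in> borel_measurable (borel \<Otimes>\<^sub>M P)"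
    by (intro measurable_compose[OF _ cp] borel_measurable_add borel_measurable_scaleR 2 4 borel_measurable_const)
  ultimately have "(\<lambda>p. (fst (fst p) - \<eta>x *\<^sub>R fst (G (fst p) (snd p)),
      closest_point Y (snd (fst p) + \<eta>y *\<^sub>R snd (G (fst p) (snd p))))) \<in> borel_measurable (borel \<Otimes>\<^sub>M P)"
    by (rule borel_measurable_Pair)
  then show ?thesis by (simp add: step_def case_prod_beta')
qed

text \<open>The iterate becomes a measurable function of a finite family of samples, so that
  independence of sample blocks applies to it.\<close>

lemma measurable_Z_canonical:
  "t \<le> n \<Longrightarrow> run (\<lambda>t i v. v (t, i)) t
    \<in> borel_measurable (PiM ({Suc 0..n} \<times> {Suc 0}) (\<lambda>_. P))"
proof (induction t)
  case (Suc t)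
  let ?Z = "run (\<lambda>t i v. v (t, i))"
  have "?Z t \<in> borel_measurable (PiM ({Suc 0..n} \<times> {Suc 0}) (\<lambda>_. P))" using Suc by simp
  moreover have "(\<lambda>v. v (Suc t, Suc 0)) \<in> measurable (PiM ({Suc 0..n} \<times> {Suc 0}) (\<lambda>_. P)) P"
    using Suc.prems by (intro measurable_component_singleton) auto
  ultimately have "(\<lambda>v. (?Z t v, v (Suc t, Suc 0))) \<in> measurable (PiM ({Suc 0..n} \<times> {Suc 0}) (\<lambda>_. P)) (borel \<Otimes>\<^sub>M P)"
    by (rule measurable_Pair)
  from measurable_compose[OF this measurable_step] show ?case
    by (simp only: run_Suc prod.case)
qed (simp add: run_0)

lemma Z_eq_canonical:
  "t \<le> n \<Longrightarrow> Z t \<omega> = run (\<lambda>t i v. v (t, i)) t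
    (restrict (\<lambda>(t, i). \<xi> t i \<omega>) ({Suc 0..n} \<times> {Suc 0}))"
  by (induction t) (simp_all add: run_0 run_Suc)

abbreviation past :: "nat \<Rightarrow> 'w \<Rightarrow> nat \<times> nat \<Rightarrow> 's" where
  "past t \<omega> \<equiv> restrict (\<lambda>(t, i). \<xi> t i \<omega>) ({Suc 0..t} \<times> {Suc 0})"

lemma measurable_\<xi>: "(t, i) \<in> sample_indices 1 \<Longrightarrow> \<xi> t i \<in> measurable W P"
  using iid unfolding iid_samples_def W.indep_vars_def by fastforce

lemma measurable_past: "past t \<in> measurable W (PiM ({Suc 0..t} \<times> {Suc 0}) (\<lambda>_. P))"
  by (rule measurable_restrict) (auto intro!: measurable_\<xi> simp: sample_indices_def)

lemma measurable_Z: "Z t \<in> borel_measurable W"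
proof -
  have "Z t = (\<lambda>\<omega>. run (\<lambda>t i v. v (t, i)) t (past t \<omega>))"
    by (rule ext) (rule Z_eq_canonical[OF order_refl])
  then show ?thesis using measurable_compose[OF measurable_past measurable_Z_canonical[OF order_refl]] by simp
qed

text \<open>Markov property: \<open>Z t\<close> depends only on the past samples, which are
  independent of the next one; the joint law is a product, and Tonelli integrates the next sample
  first, under P.\<close>

lemma nn_integral_Z_Suc:
  assumes h: "h \<in> borel_measurable borel"
  shows "(\<integral>\<^sup>+\<omega>. h (Z (Suc t) \<omega>) \<partial>W) = (\<integral>\<^sup>+\<omega>. \<integral>\<^sup>+s. h (step (Z t \<omega>) s) \<partial>P \<partial>W)"
proof -
  let ?e = "(Suc t, Suc 0)"
  let ?MA = "PiM ({Suc 0..t} \<times> {Suc 0}) (\<lambda>_. P)" and ?MB = "PiM {?e} (\<lambda>_. P)"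
  (* indep_var needs both variables to have the same type, so the next sample is also a function. *)
  let ?next = "\<lambda>\<omega>. restrict (\<lambda>(t, i). \<xi> t i \<omega>) {?e}"
  let ?Zc = "run (\<lambda>t i v. v (t, i)) t"
  have \<xi>: "\<xi> (Suc t) (Suc 0) \<in> measurable W P" by (rule measurable_\<xi>) (simp add: sample_indices_def)
  have distr_\<xi>: "distr W P (\<xi> (Suc t) (Suc 0)) = P"
    using iid by (auto simp: iid_samples_def sample_indices_def)
  have Zc: "?Zc \<in> borel_measurable ?MA" by (rule measurable_Z_canonical) simp
  have e: "(\<lambda>v. v ?e) \<in> measurable ?MB P" by (rule measurable_component_singleton) simp
  have indep_vars: "W.indep_vars (\<lambda>_. P) (\<lambda>(t, i). \<xi> t i) (sample_indices 1)"
    using iid by (simp add: iid_samples_def)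
  have "W.indep_var ?MA (past t) ?MB ?next"
    using W.indep_var_restrict[OF indep_vars, of "{Suc 0..t} \<times> {Suc 0}" "{?e}"]
    by (simp add: sample_indices_def case_prod_beta' subset_iff)
  then have "next": "?next \<in> measurable W ?MB"
    and joint: "distr W ?MA (past t) \<Otimes>\<^sub>M distr W ?MB ?next = distr W (?MA \<Otimes>\<^sub>M ?MB) (\<lambda>\<omega>. (past t \<omega>, ?next \<omega>))"
    unfolding W.indep_var_distribution_eq by auto
  interpret B: prob_space "distr W ?MB ?next" by (rule W.prob_space_distr[OF "next"])
  let ?k = "\<lambda>(u, v). h (step (?Zc u) (v ?e))"
  have hs: "(\<lambda>p. h (step (fst p) (snd p))) \<in> borel_measurable (borel \<Otimes>\<^sub>M P)"
    using measurable_compose[OF measurable_step h] by (simp add: case_prod_beta')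
  have "(\<lambda>p. (?Zc (fst p), snd p ?e)) \<in> measurable (?MA \<Otimes>\<^sub>M ?MB) (borel \<Otimes>\<^sub>M P)"
    by (intro measurable_Pair measurable_compose[OF measurable_fst Zc] measurable_compose[OF measurable_snd e])
  from measurable_compose[OF this hs] have k: "?k \<in> borel_measurable (?MA \<Otimes>\<^sub>M ?MB)"
    by (simp add: case_prod_beta')
  have inner: "(\<integral>\<^sup>+v. h (step z (v ?e)) \<partial>distr W ?MB ?next) = (\<integral>\<^sup>+s. h (step z s) \<partial>P)" for z
  proof -
    have z: "(\<lambda>s. h (step z s)) \<in> borel_measurable P"
      using measurable_compose[OF measurable_Pair1'[of z borel P] hs] by simp
    have "(\<integral>\<^sup>+v. h (step z (v ?e)) \<partial>distr W ?MB ?next) = (\<integral>\<^sup>+\<omega>. h (step z (\<xi> (Suc t) (Suc 0) \<omega>)) \<partial>W)"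
      using nn_integral_distr[OF "next", of "\<lambda>v. h (step z (v ?e))"] measurable_compose[OF e z] by simp
    also have "\<dots> = (\<integral>\<^sup>+s. h (step z s) \<partial>distr W P (\<xi> (Suc t) (Suc 0)))"
      using z by (simp add: nn_integral_distr[OF \<xi>])
    finally show ?thesis unfolding distr_\<xi> .
  qed
  have "(\<lambda>z. \<integral>\<^sup>+s. h (step z s) \<partial>P) \<in> borel_measurable borel"
    using P.borel_measurable_nn_integral_fst[OF hs] by simp
  from measurable_compose[OF Zc this]
  have m: "(\<lambda>u. \<integral>\<^sup>+s. h (step (?Zc u) s) \<partial>P) \<in> borel_measurable ?MA" .
  have "(\<integral>\<^sup>+\<omega>. h (Z (Suc t) \<omega>) \<partial>W) = (\<integral>\<^sup>+\<omega>. ?k (past t \<omega>, ?next \<omega>) \<partial>W)"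
    by (simp add: run_Suc Z_eq_canonical[OF order_refl])
  also have "\<dots> = (\<integral>\<^sup>+p. ?k p \<partial>distr W (?MA \<Otimes>\<^sub>M ?MB) (\<lambda>\<omega>. (past t \<omega>, ?next \<omega>)))"
    using k by (subst nn_integral_distr) (auto intro!: measurable_Pair measurable_past "next")
  also have "\<dots> = (\<integral>\<^sup>+p. ?k p \<partial>(distr W ?MA (past t) \<Otimes>\<^sub>M distr W ?MB ?next))"
    unfolding joint ..
  also have "\<dots> = (\<integral>\<^sup>+u. \<integral>\<^sup>+v. h (step (?Zc u) (v ?e)) \<partial>distr W ?MB ?next \<partial>distr W ?MA (past t))"
    using B.nn_integral_fst[of ?k "distr W ?MA (past t)"] k by simp
  also have "\<dots> = (\<integral>\<^sup>+u. \<integral>\<^sup>+s. h (step (?Zc u) s) \<partial>P \<partial>distr W ?MA (past t))"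
    unfolding inner ..
  also have "\<dots> = (\<integral>\<^sup>+\<omega>. \<integral>\<^sup>+s. h (step (Z t \<omega>) s) \<partial>P \<partial>W)"
    using m by (subst nn_integral_distr[OF measurable_past]) (simp_all add: Z_eq_canonical[OF order_refl])
  finally show ?thesis .
qed

section \<open>Expected decrease of the potential\<close>

lemma inf_pot_le: "inf_pot \<le> potential b y0 x y"
  using cINF_lower[OF bdd_below_env, of x] env_le_potential[of b y0 x y] b_pos y0_Y
  unfolding inf_pot_def by simp

text \<open>\<open>potential_step\<close> holds for every sample, and its majorant \<open>R\<close>
  has a computable mean: \<open>u\<close> depends on z alone and the oracle error has mean
  zero.\<close>

lemma potential_step_expectation:
  assumes y: "snd z \<in> Y"
  shows "(\<integral>\<^sup>+s. ennreal (potential b y0 (fst (step z s)) (snd (step z s)) - inf_pot) \<partial>P)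
       + ennreal (\<eta>x / 8) * ennreal ((norm (grad env (fst z)))\<^sup>2)
    \<le> ennreal (potential b y0 (fst z) (snd z) - inf_pot) + ennreal (\<eta>x * err)"
proof -
  let ?x = "fst z" and ?y = "snd z" and ?U = "potential b y0"
  obtain w where w: "is_prox (penalty b y0 ?y) ?x w" using is_prox_exists[OF continuous_penalty] by blast
  obtain v where v: "v \<in> Y" "\<And>u. u \<in> Y \<Longrightarrow> f (w, u) + penalty b y0 ?y u \<le> f (w, v) + penalty b y0 ?y v"
    using max_plus_attained[OF continuous_penalty] by metis
  define \<delta> where "\<delta> s = G z s - grad f z" for s
  define u where "u = (w - ?x, ?y - v)"
  define K where "K = ?U ?x ?y + 2 * l * \<eta>x\<^sup>2 * L\<^sup>2 - l\<^sup>2 * \<eta>x * (norm (?x - w))\<^sup>2 + 6 * l\<^sup>2 * \<eta>x * b * D\<^sup>2 - inf_pot"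
  define c where "c = 2 * l * \<eta>x\<^sup>2 + 4 * l * \<eta>x * \<eta>y"
  define R where "R s = K + 2 * l * \<eta>x * inner (\<delta> s) u + c * (norm (\<delta> s))\<^sup>2" for s
  have c_nonneg: "0 \<le> c" unfolding c_def using l_pos \<eta>x_pos \<eta>y_pos by simp
  have \<delta>: "integrable P \<delta>" "(\<integral>s. \<delta> s \<partial>P) = 0" "integrable P (\<lambda>s. (norm (\<delta> s))\<^sup>2)"
    "(\<integral>s. (norm (\<delta> s))\<^sup>2 \<partial>P) \<le> \<sigma>\<^sup>2"
    using gradient_oracle unfolding stochastic_gradient_oracle_def \<delta>_def by blast+
  have le: "?U (fst (step z s)) (snd (step z s)) - inf_pot \<le> R s" for s
  proof -
    have z: "grad f z = (gx ?x ?y, gy ?x ?y)" by simp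
    have G: "fst (G z s) = gx ?x ?y + fst (\<delta> s)" "snd (G z s) = gy ?x ?y + snd (\<delta> s)"
      by (simp_all add: \<delta>_def)
    have "?U (fst (step z s)) (snd (step z s)) \<le> ?U ?x ?y
       + 2 * l * \<eta>x * (inner (fst (\<delta> s)) (w - ?x) + inner (snd (\<delta> s)) (?y - v))
       + l * \<eta>x\<^sup>2 * (norm (gx ?x ?y + fst (\<delta> s)))\<^sup>2 + 4 * l * \<eta>x * \<eta>y * (norm (snd (\<delta> s)))\<^sup>2
       - l\<^sup>2 * \<eta>x * (norm (?x - w))\<^sup>2 + 6 * l\<^sup>2 * \<eta>x * b * D\<^sup>2"
      by (rule potential_step[OF b_pos \<eta>y_pos \<eta>x_eq \<eta>y_small y y0_Y w v])
        (simp_all only: step_def G fst_conv snd_conv)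
    moreover have "2 * l * \<eta>x * (inner (fst (\<delta> s)) (w - ?x) + inner (snd (\<delta> s)) (?y - v)) = 2 * l * \<eta>x * inner (\<delta> s) u"
      by (simp add: u_def inner_prod_def)
    moreover have "l * \<eta>x\<^sup>2 * (norm (gx ?x ?y + fst (\<delta> s)))\<^sup>2 \<le> l * \<eta>x\<^sup>2 * (2 * L\<^sup>2 + 2 * (norm (\<delta> s))\<^sup>2)"
    proof (rule mult_left_mono)
      have "(norm (gx ?x ?y))\<^sup>2 \<le> L\<^sup>2" by (intro power_mono norm_gx_le y norm_ge_zero)
      moreover have "(norm (fst (\<delta> s)))\<^sup>2 \<le> (norm (\<delta> s))\<^sup>2"
        by (simp add: norm_prod_def)
      ultimately show "(norm (gx ?x ?y + fst (\<delta> s)))\<^sup>2 \<le> 2 * L\<^sup>2 + 2 * (norm (\<delta> s))\<^sup>2"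
        using norm_add_sq_le[of "gx ?x ?y" "fst (\<delta> s)"] by linarith
    qed (use l_pos in simp)
    moreover have "4 * l * \<eta>x * \<eta>y * (norm (snd (\<delta> s)))\<^sup>2 \<le> 4 * l * \<eta>x * \<eta>y * (norm (\<delta> s))\<^sup>2"
      using l_pos \<eta>x_pos \<eta>y_pos by (intro mult_left_mono) (simp_all add: norm_prod_def)
    moreover have "l * \<eta>x\<^sup>2 * (2 * L\<^sup>2 + 2 * (norm (\<delta> s))\<^sup>2) + 4 * l * \<eta>x * \<eta>y * (norm (\<delta> s))\<^sup>2
      = 2 * l * \<eta>x\<^sup>2 * L\<^sup>2 + c * (norm (\<delta> s))\<^sup>2"
      unfolding c_def by (simp add: algebra_simps)
    ultimately show ?thesis unfolding R_def K_def by linarith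
  qed
  have R: "integrable P R"
    unfolding R_def using \<delta> by (intro Bochner_Integration.integrable_add integrable_mult_right integrable_inner_left) auto
  have "(\<integral>s. inner (\<delta> s) u \<partial>P) = 0"
    using integral_inner_left[of u P \<delta>] \<delta> by simp
  then have intR: "(\<integral>s. R s \<partial>P) = K + c * (\<integral>s. (norm (\<delta> s))\<^sup>2 \<partial>P)"
    unfolding R_def using \<delta> by (simp add: P.prob_space)
  have R_nonneg: "0 \<le> R s" for s using le[of s] inf_pot_le[of "fst (step z s)" "snd (step z s)"] by linarith
  have "(\<integral>\<^sup>+s. ennreal (?U (fst (step z s)) (snd (step z s)) - inf_pot) \<partial>P) \<le> (\<integral>\<^sup>+s. ennreal (R s) \<partial>P)"
    by (intro nn_integral_mono ennreal_leI le)
  also have "\<dots> = ennreal (\<integral>s. R s \<partial>P)"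
    using R R_nonneg by (intro nn_integral_eq_integral) auto
  also have "\<dots> \<le> ennreal (K + c * \<sigma>\<^sup>2)"
    unfolding intR using \<delta>(4) c_nonneg by (intro ennreal_leI add_left_mono mult_left_mono)
  finally have 1: "(\<integral>\<^sup>+s. ennreal (?U (fst (step z s)) (snd (step z s)) - inf_pot) \<partial>P) \<le> ennreal (K + c * \<sigma>\<^sup>2)" .
  have "0 \<le> (\<integral>s. R s \<partial>P)" using R_nonneg by (simp add: integral_nonneg_AE)
  then have nonneg: "0 \<le> K + c * \<sigma>\<^sup>2"
    unfolding intR using mult_left_mono[OF \<delta>(4) c_nonneg] by linarith
  \<comment> \<open>The weight 1 / 8 turns 8 l^2 |x - w|^2 into exactly the decrease available in
    \<open>K\<close>; the remaining 6 l^2 \<eta>x b D^2 goes into \<open>err\<close>.\<close>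
  have "\<eta>x / 8 * (norm (grad env ?x))\<^sup>2 \<le> \<eta>x / 8 * (8 * l\<^sup>2 * (norm (?x - w))\<^sup>2 + 48 * l\<^sup>2 * b * D\<^sup>2)"
    using \<eta>x_pos b_pos by (intro mult_left_mono norm_grad_env_sq_le_penalised[OF _ y y0_Y w]) auto
  then have 2: "K + c * \<sigma>\<^sup>2 + \<eta>x / 8 * (norm (grad env ?x))\<^sup>2 \<le> ?U ?x ?y - inf_pot + \<eta>x * err"
    unfolding K_def c_def err_def by (simp add: algebra_simps power2_eq_square)
  have "(\<integral>\<^sup>+s. ennreal (?U (fst (step z s)) (snd (step z s)) - inf_pot) \<partial>P)
       + ennreal (\<eta>x / 8) * ennreal ((norm (grad env ?x))\<^sup>2)
    \<le> ennreal (K + c * \<sigma>\<^sup>2) + ennreal (\<eta>x / 8) * ennreal ((norm (grad env ?x))\<^sup>2)"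
    using 1 by (rule add_right_mono)
  also have "\<dots> = ennreal (K + c * \<sigma>\<^sup>2 + \<eta>x / 8 * (norm (grad env ?x))\<^sup>2)"
    using nonneg \<eta>x_pos by (subst ennreal_mult[symmetric]) (auto simp: ennreal_plus)
  also have "\<dots> \<le> ennreal (?U ?x ?y - inf_pot + \<eta>x * err)" using 2 by (rule ennreal_leI)
  also have "\<dots> = ennreal (?U ?x ?y - inf_pot) + ennreal (\<eta>x * err)"
    using inf_pot_le[of ?x ?y] \<eta>x_pos err_nonneg by (intro ennreal_plus) auto
  finally show ?thesis .
qed

(* Nonnegative integrals, so that no integrability of the iterates has to be established. *)
definition mean_pot :: "nat \<Rightarrow> ennreal" where
  "mean_pot t = (\<integral>\<^sup>+\<omega>. ennreal (potential b y0 (fst (Z t \<omega>)) (snd (Z t \<omega>)) - inf_pot) \<partial>W)"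

definition mean_grad :: "nat \<Rightarrow> ennreal" where
  "mean_grad t = (\<integral>\<^sup>+\<omega>. ennreal ((norm (grad env (fst (Z t \<omega>))))\<^sup>2) \<partial>W)"

lemma measurable_fst_Z: "(\<lambda>\<omega>. fst (Z t \<omega>)) \<in> borel_measurable W"
  by (rule measurable_compose[OF measurable_Z])
    (auto intro!: borel_measurable_continuous_onI continuous_intros)

lemma measurable_grad_env_Z: "(\<lambda>\<omega>. grad env (fst (Z t \<omega>))) \<in> borel_measurable W"
  by (intro measurable_compose[OF measurable_fst_Z] borel_measurable_continuous_onI
      continuous_grad_env_plus) simp

lemma measurable_potential:
  "(\<lambda>z. ennreal (potential b y0 (fst z) (closest_point Y (snd z)) - inf_pot)) \<in> borel_measurable borel"
proof -
  have "(\<lambda>z. potential b y0 (fst z) (closest_point Y (snd z))) \<in> borel_measurable borel"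
    by (intro borel_measurable_continuous_onI continuous_potential) (use b_pos in simp)
  then show ?thesis by measurable
qed

lemma mean_pot_Suc: "mean_pot (Suc t) + ennreal (\<eta>x / 8) * mean_grad t \<le> mean_pot t + ennreal (\<eta>x * err)"
proof -
  let ?h = "\<lambda>z. ennreal (potential b y0 (fst z) (snd z) - inf_pot)"
  let ?k = "\<lambda>z. ennreal (potential b y0 (fst z) (closest_point Y (snd z)) - inf_pot)"
  have k: "?k \<in> borel_measurable borel" by (rule measurable_potential)
  \<comment> \<open>\<open>?k\<close> is the form known to be measurable, \<open>?h\<close> the one
    in \<open>mean_pot\<close>; they agree where the run lives.\<close>
  have kh: "?k z = ?h z" if "snd z \<in> Y" for z using closest_point_self[OF that] by simp
  have g: "(\<lambda>\<omega>. ennreal (\<eta>x / 8) * ennreal ((norm (grad env (fst (Z t \<omega>))))\<^sup>2)) \<in> borel_measurable W"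
    using measurable_grad_env_Z by measurable
  have "(\<lambda>p. ?k (step (fst p) (snd p))) \<in> borel_measurable (borel \<Otimes>\<^sub>M P)"
    using measurable_compose[OF measurable_step k] by (simp add: case_prod_beta')
  from measurable_compose[OF measurable_Z P.borel_measurable_nn_integral_fst[OF this]]
  have m: "(\<lambda>\<omega>. \<integral>\<^sup>+s. ?k (step (Z t \<omega>) s) \<partial>P) \<in> borel_measurable W" by simp
  have m': "(\<lambda>\<omega>. ?k (Z t \<omega>)) \<in> borel_measurable W"
    by (rule measurable_compose[OF measurable_Z k])
  have "mean_pot (Suc t) = (\<integral>\<^sup>+\<omega>. ?k (Z (Suc t) \<omega>) \<partial>W)"
    unfolding mean_pot_def by (simp only: kh[OF snd_Z])
  also have "\<dots> = (\<integral>\<^sup>+\<omega>. \<integral>\<^sup>+s. ?k (step (Z t \<omega>) s) \<partial>P \<partial>W)" by (rule nn_integral_Z_Suc[OF k])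
  finally have "mean_pot (Suc t) + ennreal (\<eta>x / 8) * mean_grad t
    = (\<integral>\<^sup>+\<omega>. (\<integral>\<^sup>+s. ?k (step (Z t \<omega>) s) \<partial>P) + ennreal (\<eta>x / 8) * ennreal ((norm (grad env (fst (Z t \<omega>))))\<^sup>2) \<partial>W)"
    unfolding mean_grad_def using m g measurable_grad_env_Z
    by (subst nn_integral_add) (auto simp: nn_integral_cmult)
  also have "\<dots> \<le> (\<integral>\<^sup>+\<omega>. ?k (Z t \<omega>) + ennreal (\<eta>x * err) \<partial>W)"
    by (intro nn_integral_mono) (simp only: kh[OF snd_Z] kh[OF snd_step] potential_step_expectation[OF snd_Z])
  also have "\<dots> = (\<integral>\<^sup>+\<omega>. ?k (Z t \<omega>) \<partial>W) + ennreal (\<eta>x * err)"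
    using m' by (subst nn_integral_add) (auto simp: W.emeasure_space_1)
  also have "\<dots> = mean_pot t + ennreal (\<eta>x * err)"
    unfolding mean_pot_def by (simp only: kh[OF snd_Z])
  finally show ?thesis .
qed

section \<open>Summation over the run\<close>

text \<open>Both terms on the left are kept because each is used: dropping the first bounds the sum
  of gradients, dropping the second bounds the potential at a single time.\<close>

lemma mean_pot_telescope:
  "mean_pot t + ennreal (\<eta>x / 8) * (\<Sum>i<t. mean_grad i)
    \<le> ennreal (env x0 - (INF x. env x) + 2 * (l * b * D\<^sup>2) + real t * (\<eta>x * err))"
proof (induction t)
  case 0
  have "mean_pot 0 = ennreal (potential b y0 x0 y0 - inf_pot)"
    by (simp add: mean_pot_def run_0 W.emeasure_space_1)
  also have "\<dots> \<le> ennreal (env x0 - (INF x. env x) + 2 * (l * b * D\<^sup>2))"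
    using potential_start_le[of b y0 x0] b_pos unfolding inf_pot_def by (intro ennreal_leI) simp
  finally show ?case by simp
next
  case (Suc t)
  let ?c = "env x0 - (INF x. env x) + 2 * (l * b * D\<^sup>2)"
  have c: "0 \<le> ?c" using cINF_lower[OF bdd_below_env, of x0] l_pos b_pos by simp
  have "mean_pot (Suc t) + ennreal (\<eta>x / 8) * (\<Sum>i<Suc t. mean_grad i)
      = (mean_pot (Suc t) + ennreal (\<eta>x / 8) * mean_grad t) + ennreal (\<eta>x / 8) * (\<Sum>i<t. mean_grad i)"
    by (simp add: distrib_left ac_simps)
  also have "\<dots> \<le> (mean_pot t + ennreal (\<eta>x * err)) + ennreal (\<eta>x / 8) * (\<Sum>i<t. mean_grad i)"
    by (intro add_right_mono mean_pot_Suc)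
  also have "\<dots> = (mean_pot t + ennreal (\<eta>x / 8) * (\<Sum>i<t. mean_grad i)) + ennreal (\<eta>x * err)"
    by (simp add: ac_simps)
  also have "\<dots> \<le> ennreal (?c + real t * (\<eta>x * err)) + ennreal (\<eta>x * err)"
    using Suc by (rule add_right_mono)
  also have "\<dots> = ennreal (?c + real (Suc t) * (\<eta>x * err))"
    using c \<eta>x_pos err_nonneg by (subst ennreal_plus[symmetric]) (auto simp: distrib_right)
  finally show ?case .
qed

lemma mean_grad_sum_le:
  "(\<Sum>i<t. mean_grad i) \<le> ennreal (8 / \<eta>x * (env x0 - (INF x. env x) + 2 * (l * b * D\<^sup>2)) + 8 * real t * err)"
proof -
  let ?c = "env x0 - (INF x. env x) + 2 * (l * b * D\<^sup>2)"
  have "ennreal (\<eta>x / 8) * (\<Sum>i<t. mean_grad i) \<le> ennreal (?c + real t * (\<eta>x * err))"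
    by (rule order_trans[OF _ mean_pot_telescope]) simp
  then have "ennreal (8 / \<eta>x) * (ennreal (\<eta>x / 8) * (\<Sum>i<t. mean_grad i)) \<le> ennreal (8 / \<eta>x) * ennreal (?c + real t * (\<eta>x * err))"
    by (rule mult_left_mono) simp
  moreover have "ennreal (8 / \<eta>x) * (ennreal (\<eta>x / 8) * (\<Sum>i<t. mean_grad i)) = (\<Sum>i<t. mean_grad i)"
    using \<eta>x_pos by (simp flip: mult.assoc ennreal_mult)
  moreover have "ennreal (8 / \<eta>x) * ennreal (?c + real t * (\<eta>x * err)) = ennreal (8 / \<eta>x * ?c + 8 * real t * err)"
    using \<eta>x_pos by (simp add: distrib_left mult.assoc flip: ennreal_mult')
  ultimately show ?thesis by simp
qed

text \<open>The bound for short runs. It has no factor 1 / \<eta>x, since the squared gradient is at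
  most 4 l times the envelope gap, which the potential above \<open>inf_pot\<close>
  dominates.\<close>

lemma mean_grad_le:
  "mean_grad t \<le> ennreal (4 * l * (env x0 - (INF x. env x) + 2 * (l * b * D\<^sup>2) + real t * (\<eta>x * err)))"
proof -
  have "mean_grad t \<le> (\<integral>\<^sup>+\<omega>. ennreal (4 * l) * ennreal (potential b y0 (fst (Z t \<omega>)) (closest_point Y (snd (Z t \<omega>))) - inf_pot) \<partial>W)"
    unfolding mean_grad_def
  proof (rule nn_integral_mono)
    fix \<omega>
    let ?x = "fst (Z t \<omega>)" and ?y = "snd (Z t \<omega>)"
    have "(norm (grad env ?x))\<^sup>2 \<le> 4 * l * (env ?x - (INF x. env x))"
      using cINF_lower[OF bdd_below_env] by (intro norm_grad_env_plus_sq_le) auto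
    also have "\<dots> \<le> 4 * l * (potential b y0 ?x ?y - inf_pot)"
      using env_le_potential[of b y0 ?x ?y] b_pos y0_Y l_pos unfolding inf_pot_def by (intro mult_left_mono) auto
    finally show "ennreal ((norm (grad env ?x))\<^sup>2) \<le> ennreal (4 * l) * ennreal (potential b y0 ?x (closest_point Y ?y) - inf_pot)"
      using l_pos inf_pot_le closest_point_self[OF snd_Z[of t \<omega>]] by (simp add: ennreal_leI flip: ennreal_mult)
  qed
  also have "\<dots> = ennreal (4 * l) * mean_pot t"
    using measurable_compose[OF measurable_Z measurable_potential, of t] closest_point_self[OF snd_Z]
    by (subst nn_integral_cmult) (simp_all add: mean_pot_def)
  also have "\<dots> \<le> ennreal (4 * l) * ennreal (env x0 - (INF x. env x) + 2 * (l * b * D\<^sup>2) + real t * (\<eta>x * err))"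
    by (intro mult_left_mono order_trans[OF _ mean_pot_telescope]) auto
  also have "\<dots> = ennreal (4 * l * (env x0 - (INF x. env x) + 2 * (l * b * D\<^sup>2) + real t * (\<eta>x * err)))"
    using l_pos by (simp flip: ennreal_mult')
  finally show ?thesis .
qed

end

section \<open>Step sizes and complexity\<close>

text \<open>The ratios bounded by \<kappa> convert powers of \<epsilon>: \<epsilon>^2 <= \<kappa>^2
  \<sigma>^2 makes l \<eta>y small, and \<epsilon>^2 <= \<kappa>^2 l^2 D^2 absorbs l^2 D^2 in the
  bound on l \<eta>x (L^2 + \<sigma>^2).\<close>

lemma step_size_bounds:
  fixes l L D \<sigma> \<epsilon> \<eta>x \<eta>y \<kappa> :: real
  assumes "0 < l" "0 < \<epsilon>" "1 \<le> \<kappa>" "0 \<le> \<sigma>" "0 \<le> D" and \<sigma>: "\<epsilon> \<le> \<kappa> * \<sigma>" and D: "\<epsilon> \<le> \<kappa> * (l * D)"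
    and \<eta>x: "theta_with (eta_x_lo \<kappa>) (eta_x_hi \<kappa>) (\<epsilon> ^ 4 / (l ^ 3 * D\<^sup>2 * (L\<^sup>2 + \<sigma>\<^sup>2))) \<eta>x"
    and \<eta>y: "theta_with (eta_y_lo \<kappa>) (eta_y_hi \<kappa>) (\<epsilon>\<^sup>2 / (l * \<sigma>\<^sup>2)) \<eta>y"
  shows "0 < \<eta>x" "0 < \<eta>y" "12 * (l * \<eta>y) \<le> 1"
    and "l * \<eta>x * (L\<^sup>2 + \<sigma>\<^sup>2) \<le> \<epsilon>\<^sup>2 / 10 ^ 15"
    and "l * \<eta>y * \<sigma>\<^sup>2 \<le> \<epsilon>\<^sup>2 / 10 ^ 5"
    and "l\<^sup>2 * (\<eta>x / \<eta>y) * D\<^sup>2 \<le> \<epsilon>\<^sup>2 / 10 ^ 9"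
    and "l * \<eta>x * (64 * 10 ^ 6 * \<kappa>\<^sup>2 * l\<^sup>2 * D\<^sup>2 * \<sigma>\<^sup>2 / \<epsilon> ^ 4) \<le> 1 / 10 ^ 7"
    and "1 / \<eta>x \<le> 10 ^ 16 * \<kappa> ^ 4 * (l ^ 3 * D\<^sup>2 * (L\<^sup>2 + \<sigma>\<^sup>2)) / \<epsilon> ^ 4"
    and "1 / \<eta>y \<le> 10 ^ 6 * \<kappa>\<^sup>2 * (l * \<sigma>\<^sup>2) / \<epsilon>\<^sup>2"
proof -
  define S where "S = L\<^sup>2 + \<sigma>\<^sup>2"
  define X where "X = l ^ 3 * D\<^sup>2 * S"
  define V where "V = l * \<sigma>\<^sup>2"
  have \<sigma>_pos: "0 < \<sigma>" using assms(2,4) \<sigma> by (cases "\<sigma> = 0") auto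
  have D_pos: "0 < D" using assms(2,5) D by (cases "D = 0") auto
  have \<sigma>S: "\<sigma>\<^sup>2 \<le> S" unfolding S_def by simp
  have S_pos: "0 < S" using \<sigma>_pos \<sigma>S by (metis less_le_trans zero_less_power)
  have X_pos: "0 < X" and V_pos: "0 < V" unfolding X_def V_def using assms(1) D_pos S_pos \<sigma>_pos by auto
  have \<kappa>: "1 \<le> \<kappa>\<^sup>2" "\<kappa>\<^sup>2 \<le> \<kappa> ^ 4" "0 < \<kappa>"
    using assms(3) power_increasing[of 2 4 \<kappa>] by auto
  have \<kappa>4: "\<kappa> ^ 4 = \<kappa>\<^sup>2 * \<kappa>\<^sup>2" and \<epsilon>4: "\<epsilon> ^ 4 = \<epsilon>\<^sup>2 * \<epsilon>\<^sup>2" by (simp_all flip: power_add)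
  have \<epsilon>\<sigma>: "\<epsilon>\<^sup>2 \<le> \<kappa>\<^sup>2 * \<sigma>\<^sup>2" and \<epsilon>D: "\<epsilon>\<^sup>2 \<le> \<kappa>\<^sup>2 * (l\<^sup>2 * D\<^sup>2)"
    using power_mono[OF \<sigma>, of 2] power_mono[OF D, of 2] assms(2) by (simp_all add: power_mult_distrib)
  have x_lo: "\<epsilon> ^ 4 \<le> \<eta>x * (10 ^ 16 * \<kappa> ^ 4 * X)" and x_hi: "\<eta>x * (10 ^ 15 * \<kappa> ^ 4 * X) \<le> \<epsilon> ^ 4"
    using \<eta>x X_pos \<kappa>(3) unfolding theta_with_def eta_x_lo_def eta_x_hi_def S_def[symmetric] X_def[symmetric]
    by (simp_all add: field_simps)
  have y_lo: "\<epsilon>\<^sup>2 \<le> \<eta>y * (10 ^ 6 * \<kappa>\<^sup>2 * V)" and y_hi: "\<eta>y * (10 ^ 5 * \<kappa>\<^sup>2 * V) \<le> \<epsilon>\<^sup>2"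
    using \<eta>y V_pos \<kappa>(3) unfolding theta_with_def eta_y_lo_def eta_y_hi_def V_def[symmetric]
    by (simp_all add: field_simps)
  have "0 < \<eta>x * (10 ^ 16 * \<kappa> ^ 4 * X)" using x_lo assms(2) by (metis less_le_trans zero_less_power)
  then show \<eta>x_pos: "0 < \<eta>x" by (rule zero_less_mult_pos2) (use \<kappa>(3) X_pos in simp)
  have "0 < \<eta>y * (10 ^ 6 * \<kappa>\<^sup>2 * V)" using y_lo assms(2) by (metis less_le_trans zero_less_power)
  then show \<eta>y_pos: "0 < \<eta>y" by (rule zero_less_mult_pos2) (use \<kappa>(3) V_pos in simp)
  show "1 / \<eta>x \<le> 10 ^ 16 * \<kappa> ^ 4 * (l ^ 3 * D\<^sup>2 * (L\<^sup>2 + \<sigma>\<^sup>2)) / \<epsilon> ^ 4"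
    unfolding S_def[symmetric] X_def[symmetric] using x_lo \<eta>x_pos assms(2) by (simp add: field_simps)
  show "1 / \<eta>y \<le> 10 ^ 6 * \<kappa>\<^sup>2 * (l * \<sigma>\<^sup>2) / \<epsilon>\<^sup>2"
    unfolding V_def[symmetric] using y_lo \<eta>y_pos assms(2) by (simp add: field_simps)

  have "\<eta>y * V * 10 ^ 5 * 1 \<le> \<eta>y * V * 10 ^ 5 * \<kappa>\<^sup>2"
    using \<eta>y_pos V_pos \<kappa>(1) by (intro mult_left_mono) auto
  then show "l * \<eta>y * \<sigma>\<^sup>2 \<le> \<epsilon>\<^sup>2 / 10 ^ 5" using y_hi unfolding V_def by (simp add: ac_simps)
  have "(\<kappa>\<^sup>2 * \<sigma>\<^sup>2) * (10 ^ 5 * (l * \<eta>y)) \<le> (\<kappa>\<^sup>2 * \<sigma>\<^sup>2) * 1"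
    using order_trans[OF y_hi \<epsilon>\<sigma>] unfolding V_def by (simp add: ac_simps)
  then have "10 ^ 5 * (l * \<eta>y) \<le> 1"
    using \<kappa>(3) \<sigma>_pos by (subst (asm) mult_le_cancel_left_pos) auto
  then show "12 * (l * \<eta>y) \<le> 1" by simp

  have "\<epsilon>\<^sup>2 * (10 ^ 15 * (l * \<eta>x * S)) \<le> (\<kappa>\<^sup>2 * (l\<^sup>2 * D\<^sup>2)) * (10 ^ 15 * (l * \<eta>x * S))"
    using \<epsilon>D assms(1) \<eta>x_pos S_pos by (intro mult_right_mono) auto
  also have "\<dots> = 1 * (\<eta>x * (10 ^ 15 * \<kappa>\<^sup>2 * X))"
    unfolding X_def by (simp add: power2_eq_square power3_eq_cube)
  also have "\<dots> \<le> \<kappa>\<^sup>2 * (\<eta>x * (10 ^ 15 * \<kappa>\<^sup>2 * X))"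
    using \<kappa> \<eta>x_pos X_pos by (intro mult_right_mono) auto
  also have "\<dots> \<le> \<epsilon>\<^sup>2 * \<epsilon>\<^sup>2" using x_hi unfolding \<kappa>4 \<epsilon>4 by (simp add: ac_simps)
  finally have "10 ^ 15 * (l * \<eta>x * S) \<le> \<epsilon>\<^sup>2"
    using assms(2) by (subst (asm) mult_le_cancel_left_pos) auto
  then show "l * \<eta>x * (L\<^sup>2 + \<sigma>\<^sup>2) \<le> \<epsilon>\<^sup>2 / 10 ^ 15" unfolding S_def by simp

  \<comment> \<open>The ratio of the steps: the upper constant of \<eta>x against the lower one of
    \<eta>y, 10^15 / 10^6, gives 10^9; one factor \<epsilon>^2 is traded for \<eta>y.\<close>
  have "\<eta>x * (10 ^ 15 * \<kappa> ^ 4 * X) \<le> \<epsilon>\<^sup>2 * (\<eta>y * (10 ^ 6 * \<kappa>\<^sup>2 * V))"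
    by (rule order_trans[OF x_hi[unfolded \<epsilon>4] mult_left_mono[OF y_lo]]) simp
  also have "\<dots> \<le> \<epsilon>\<^sup>2 * (\<eta>y * (10 ^ 6 * \<kappa>\<^sup>2 * (l * S)))"
    unfolding V_def using \<sigma>S \<eta>y_pos assms(1) by (intro mult_left_mono) auto
  finally have "(10 ^ 6 * \<kappa>\<^sup>2 * l * S) * (10 ^ 9 * (l\<^sup>2 * \<eta>x * D\<^sup>2) * \<kappa>\<^sup>2) \<le> (10 ^ 6 * \<kappa>\<^sup>2 * l * S) * (\<epsilon>\<^sup>2 * \<eta>y)"
    unfolding X_def \<kappa>4 by (simp add: power2_eq_square power3_eq_cube ac_simps)
  then have "10 ^ 9 * (l\<^sup>2 * \<eta>x * D\<^sup>2) * \<kappa>\<^sup>2 \<le> \<epsilon>\<^sup>2 * \<eta>y"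
    using \<kappa>(3) assms(1) S_pos by (subst (asm) mult_le_cancel_left_pos) auto
  moreover have "10 ^ 9 * (l\<^sup>2 * \<eta>x * D\<^sup>2) * 1 \<le> 10 ^ 9 * (l\<^sup>2 * \<eta>x * D\<^sup>2) * \<kappa>\<^sup>2"
    using \<eta>x_pos \<kappa>(1) by (intro mult_left_mono) auto
  ultimately show "l\<^sup>2 * (\<eta>x / \<eta>y) * D\<^sup>2 \<le> \<epsilon>\<^sup>2 / 10 ^ 9"
    using \<eta>y_pos by (simp add: field_simps)

  have "\<eta>x * (10 ^ 15 * \<kappa>\<^sup>2 * (l ^ 3 * D\<^sup>2 * \<sigma>\<^sup>2)) \<le> \<eta>x * (10 ^ 15 * \<kappa> ^ 4 * X)"
    unfolding X_def using \<eta>x_pos \<kappa> \<sigma>S assms(1) by (intro mult_left_mono mult_mono) auto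
  then have "\<eta>x * (10 ^ 15 * \<kappa>\<^sup>2 * (l ^ 3 * D\<^sup>2 * \<sigma>\<^sup>2)) \<le> \<epsilon> ^ 4" using x_hi by (rule order_trans)
  moreover have "l * \<eta>x * (64 * 10 ^ 6 * \<kappa>\<^sup>2 * l\<^sup>2 * D\<^sup>2 * \<sigma>\<^sup>2 / \<epsilon> ^ 4)
    = 64 / 10 ^ 9 * (\<eta>x * (10 ^ 15 * \<kappa>\<^sup>2 * (l ^ 3 * D\<^sup>2 * \<sigma>\<^sup>2)) / \<epsilon> ^ 4)"
    by (simp add: power2_eq_square power3_eq_cube)
  moreover have "64 / 10 ^ 9 * (r / \<epsilon> ^ 4) \<le> 64 / 10 ^ 9 * 1" if "r \<le> \<epsilon> ^ 4" for r
    using that assms(2) by (intro mult_left_mono) auto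
  ultimately have "l * \<eta>x * (64 * 10 ^ 6 * \<kappa>\<^sup>2 * l\<^sup>2 * D\<^sup>2 * \<sigma>\<^sup>2 / \<epsilon> ^ 4) \<le> 64 / 10 ^ 9 * 1"
    by presburger
  then show "l * \<eta>x * (64 * 10 ^ 6 * \<kappa>\<^sup>2 * l\<^sup>2 * D\<^sup>2 * \<sigma>\<^sup>2 / \<epsilon> ^ 4) \<le> 1 / 10 ^ 7"
    by (rule order_trans) simp
qed

text \<open>N is the run length from which the extra 2 l b D^2 in the potential is cheap: 16 l b D^2
  / \<eta>x = 16 l D^2 / \<eta>y <= N \<epsilon>^2 / 4 by \<open>b6\<close>.\<close>

lemma (in sgda_run) mean_grad_sum_le_sq:
  fixes T :: nat and \<kappa> \<epsilon> :: real
  defines "\<Delta> \<equiv> env x0 - (INF x. env x)"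
    and "N \<equiv> 64 * 10 ^ 6 * \<kappa>\<^sup>2 * l\<^sup>2 * D\<^sup>2 * \<sigma>\<^sup>2 / \<epsilon> ^ 4"
  assumes b_eq: "b = \<eta>x / \<eta>y" and \<epsilon>: "0 < \<epsilon>" and \<kappa>: "1 \<le> \<kappa>" and D: "0 < D" and \<sigma>: "0 < \<sigma>"
    and T: "1 \<le> T" "10 ^ 24 * \<kappa> ^ 4 * (l ^ 3 * (L\<^sup>2 + \<sigma>\<^sup>2) * D\<^sup>2 * \<Delta> / \<epsilon> ^ 6) \<le> 2 * real T"
    and b1: "l * \<eta>x * (L\<^sup>2 + \<sigma>\<^sup>2) \<le> \<epsilon>\<^sup>2 / 10 ^ 15"
    and b2: "l * \<eta>y * \<sigma>\<^sup>2 \<le> \<epsilon>\<^sup>2 / 10 ^ 5"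
    and b3: "l\<^sup>2 * (\<eta>x / \<eta>y) * D\<^sup>2 \<le> \<epsilon>\<^sup>2 / 10 ^ 9"
    and b4: "l * \<eta>x * N \<le> 1 / 10 ^ 7"
    and b5: "1 / \<eta>x \<le> 10 ^ 16 * \<kappa> ^ 4 * (l ^ 3 * D\<^sup>2 * (L\<^sup>2 + \<sigma>\<^sup>2)) / \<epsilon> ^ 4"
    and b6: "1 / \<eta>y \<le> 10 ^ 6 * \<kappa>\<^sup>2 * (l * \<sigma>\<^sup>2) / \<epsilon>\<^sup>2"
  shows "(\<Sum>j = 1..T. mean_grad j) \<le> ennreal (real T * \<epsilon>\<^sup>2)"
proof -
  have \<Delta>: "0 \<le> \<Delta>" using cINF_lower[OF bdd_below_env, of x0] by (simp add: \<Delta>_def)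
  have "err = 2 * (l * \<eta>x * (L\<^sup>2 + \<sigma>\<^sup>2)) + 4 * (l * \<eta>y * \<sigma>\<^sup>2) + 12 * (l\<^sup>2 * (\<eta>x / \<eta>y) * D\<^sup>2)"
    unfolding err_def b_eq[symmetric] by (simp add: algebra_simps)
  moreover have combine: "2 * r + 4 * s + 12 * u \<le> e / 10 ^ 4"
    if "r \<le> e / 10 ^ 15" "s \<le> e / 10 ^ 5" "u \<le> e / 10 ^ 9" "0 \<le> e" for r s u e :: real
    using that by simp
  ultimately have err: "err \<le> \<epsilon>\<^sup>2 / 10 ^ 4"
    using combine[OF b1 b2 b3 zero_le_power2] by presburger
  have \<epsilon>6: "\<epsilon> ^ 6 = \<epsilon> ^ 4 * \<epsilon>\<^sup>2" by (simp flip: power_add)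
  define A where "A = l ^ 3 * (L\<^sup>2 + \<sigma>\<^sup>2) * D\<^sup>2 * \<Delta> / \<epsilon> ^ 6"
  have cancel: "r / (a * c) * c = r / a" if "c \<noteq> 0" for r a c :: real using that by simp
  have A\<epsilon>: "A * \<epsilon>\<^sup>2 = l ^ 3 * (L\<^sup>2 + \<sigma>\<^sup>2) * D\<^sup>2 * \<Delta> / \<epsilon> ^ 4"
    unfolding A_def \<epsilon>6 by (rule cancel) (use \<epsilon> in simp)
  have A: "10 ^ 24 * (\<kappa> ^ 4 * A) \<le> 2 * real T" using T(2) unfolding A_def by simp
  have lbD: "l * (l * b * D\<^sup>2) \<le> \<epsilon>\<^sup>2 / 10 ^ 9" using b3 unfolding b_eq by (simp add: power2_eq_square)
  show ?thesis
  proof (cases "N \<le> real T")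
    case True
    have "1 / \<eta>x * \<Delta> \<le> 10 ^ 16 * \<kappa> ^ 4 * (l ^ 3 * D\<^sup>2 * (L\<^sup>2 + \<sigma>\<^sup>2)) / \<epsilon> ^ 4 * \<Delta>"
      using b5 \<Delta> by (rule mult_right_mono)
    also have "\<dots> = 10 ^ 16 * \<kappa> ^ 4 * (l ^ 3 * (L\<^sup>2 + \<sigma>\<^sup>2) * D\<^sup>2 * \<Delta> / \<epsilon> ^ 4)"
      by (simp only: times_divide_eq_left times_divide_eq_right ac_simps)
    also have "\<dots> = 10 ^ 16 * (\<kappa> ^ 4 * A) * \<epsilon>\<^sup>2" unfolding A\<epsilon>[symmetric] by simp
    also have "\<dots> \<le> real T / 10 ^ 7 * \<epsilon>\<^sup>2"
    proof (rule mult_right_mono)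
      have "10 ^ 16 * r \<le> real T / 10 ^ 7" if "10 ^ 24 * r \<le> 2 * real T" for r
        using that by simp
      then show "10 ^ 16 * (\<kappa> ^ 4 * A) \<le> real T / 10 ^ 7" using A by blast
    qed simp
    finally have 1: "8 / \<eta>x * \<Delta> \<le> 8 / 10000000 * (real T * \<epsilon>\<^sup>2)" by (simp add: mult.commute)
    have "1 / \<eta>x * (l * b * D\<^sup>2) = 1 / \<eta>y * (l * D\<^sup>2)"
      unfolding b_eq using \<eta>x_pos by simp
    also have "\<dots> \<le> 10 ^ 6 * \<kappa>\<^sup>2 * (l * \<sigma>\<^sup>2) / \<epsilon>\<^sup>2 * (l * D\<^sup>2)"
      using b6 l_pos by (intro mult_right_mono) auto
    also have "\<dots> = N / 64 * \<epsilon>\<^sup>2"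
      unfolding N_def using \<epsilon> by (simp add: field_simps power2_eq_square power4_eq_xxxx)
    also have "\<dots> \<le> real T / 64 * \<epsilon>\<^sup>2" using True by (intro mult_right_mono) auto
    finally have 2: "8 / \<eta>x * (2 * (l * b * D\<^sup>2)) \<le> 1 / 4 * (real T * \<epsilon>\<^sup>2)" by (simp add: ac_simps)
    \<comment> \<open>The sum over 1..T is part of the one over 0..T, hence \<open>Suc T\<close>,
      which is at most 2 T.\<close>
    have "8 * real (Suc T) * err \<le> 16 * real T * (\<epsilon>\<^sup>2 / 10 ^ 4)"
      by (rule mult_mono[OF _ err]) (use T(1) err_nonneg in auto)
    then have 3: "8 * real (Suc T) * err \<le> 16 / 10000 * (real T * \<epsilon>\<^sup>2)" by (simp add: ac_simps)
    have "0 \<le> real T * \<epsilon>\<^sup>2" by simp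
    \<comment> \<open>The shares 8 / 10^7, 1 / 4 and 16 / 10^4 add up to less than 1.\<close>
    with 1 2 3 have "8 / \<eta>x * (\<Delta> + 2 * (l * b * D\<^sup>2)) + 8 * real (Suc T) * err \<le> real T * \<epsilon>\<^sup>2"
      unfolding distrib_left by linarith
    then have "(\<Sum>i<Suc T. mean_grad i) \<le> ennreal (real T * \<epsilon>\<^sup>2)"
      by (intro order_trans[OF mean_grad_sum_le[of "Suc T"]] ennreal_leI) (simp add: \<Delta>_def)
    moreover have "(\<Sum>j = 1..T. mean_grad j) \<le> (\<Sum>i<Suc T. mean_grad i)"
      by (intro sum_mono2) auto
    ultimately show ?thesis by (rule order_trans[rotated])
  next
    case False
    have "10 ^ 24 * (\<kappa> ^ 4 * A) \<le> 2 * N" using A False by linarith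
    \<comment> \<open>This multiplication clears D; after cancelling \<kappa>^2, l \<Delta> stands
      against \<epsilon>^2 with the factors \<kappa>^2 (L^2 + \<sigma>^2) and \<sigma>^2, the first
      being the larger.\<close>
    then have "10 ^ 24 * (\<kappa> ^ 4 * A) * (\<epsilon> ^ 6 / (l\<^sup>2 * D\<^sup>2)) \<le> 2 * N * (\<epsilon> ^ 6 / (l\<^sup>2 * D\<^sup>2))"
      using \<epsilon> by (intro mult_right_mono) auto
    moreover have "10 ^ 24 * (\<kappa> ^ 4 * A) * (\<epsilon> ^ 6 / (l\<^sup>2 * D\<^sup>2)) = \<kappa>\<^sup>2 * (\<kappa>\<^sup>2 * (L\<^sup>2 + \<sigma>\<^sup>2) * (10 ^ 24 * (l * \<Delta>)))"
      unfolding A_def using \<epsilon> l_pos D by (simp add: field_simps power2_eq_square power3_eq_cube power4_eq_xxxx)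
    moreover have "2 * N * (\<epsilon> ^ 6 / (l\<^sup>2 * D\<^sup>2)) = \<kappa>\<^sup>2 * (\<sigma>\<^sup>2 * (128 * 10 ^ 6 * \<epsilon>\<^sup>2))"
      unfolding N_def \<epsilon>6 using \<epsilon> l_pos D by (simp add: field_simps)
    ultimately have "\<kappa>\<^sup>2 * (L\<^sup>2 + \<sigma>\<^sup>2) * (10 ^ 24 * (l * \<Delta>)) \<le> \<sigma>\<^sup>2 * (128 * 10 ^ 6 * \<epsilon>\<^sup>2)"
      using \<kappa> by (simp add: mult_le_cancel_left_pos)
    moreover have "\<sigma>\<^sup>2 * (10 ^ 24 * (l * \<Delta>)) \<le> \<kappa>\<^sup>2 * (L\<^sup>2 + \<sigma>\<^sup>2) * (10 ^ 24 * (l * \<Delta>))"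
    proof (rule mult_right_mono)
      have "1 * \<sigma>\<^sup>2 \<le> \<kappa>\<^sup>2 * (L\<^sup>2 + \<sigma>\<^sup>2)" using \<kappa> by (intro mult_mono) auto
      then show "\<sigma>\<^sup>2 \<le> \<kappa>\<^sup>2 * (L\<^sup>2 + \<sigma>\<^sup>2)" by simp
    qed (use \<Delta> l_pos in simp)
    ultimately have "\<sigma>\<^sup>2 * (10 ^ 24 * (l * \<Delta>)) \<le> \<sigma>\<^sup>2 * (128 * 10 ^ 6 * \<epsilon>\<^sup>2)" by linarith
    then have 1: "10 ^ 24 * (l * \<Delta>) \<le> 128 * 10 ^ 6 * \<epsilon>\<^sup>2" using \<sigma> by (subst (asm) mult_le_cancel_left_pos) auto
    \<comment> \<open>Here r is l \<Delta>, s the contribution of the penalty, and u the error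
      accumulated over fewer than N steps.\<close>
    have combine: "4 * r + 8 * s + 4 * u \<le> e"
      if "10 ^ 24 * r \<le> 128 * 10 ^ 6 * e" "s \<le> e / 10 ^ 9" "u \<le> 1 / 10 ^ 7 * (e / 10 ^ 4)" "0 \<le> e"
      for r s u e :: real
      using that by simp
    have "mean_grad j \<le> ennreal (\<epsilon>\<^sup>2)" if j: "j \<in> {1..T}" for j
    proof -
      have "l * \<eta>x * real j * err \<le> (1 / 10 ^ 7) * (\<epsilon>\<^sup>2 / 10 ^ 4)"
      proof (rule mult_mono[OF _ err])
        have "l * \<eta>x * real j \<le> l * \<eta>x * N" using j False l_pos \<eta>x_pos by (intro mult_left_mono) auto
        then show "l * \<eta>x * real j \<le> 1 / 10 ^ 7" using b4 by linarith
      qed (use err_nonneg in auto)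
      from combine[OF 1 lbD this zero_le_power2]
      have "4 * l * (\<Delta> + 2 * (l * b * D\<^sup>2) + real j * (\<eta>x * err)) \<le> \<epsilon>\<^sup>2"
        by (simp add: algebra_simps)
      then show ?thesis
        by (intro order_trans[OF mean_grad_le] ennreal_leI) (simp add: \<Delta>_def)
    qed
    then have "(\<Sum>j = 1..T. mean_grad j) \<le> (\<Sum>j = 1..T. ennreal (\<epsilon>\<^sup>2))" by (rule sum_mono)
    also have "\<dots> = ennreal (real T * \<epsilon>\<^sup>2)"
      by (simp add: ennreal_of_nat_eq_real_of_nat flip: ennreal_mult)
    finally show ?thesis .
  qed
qed

section \<open>Iteration and oracle complexity\<close>

lemma sgda_oracle_calls_one: "sgda_oracle_calls 1 T = T"
proof -
  have "{(t, i) \<in> sample_indices 1. t \<le> T} = {1..T} \<times> {1}" by (auto simp: sample_indices_def)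
  then show ?thesis by (simp add: sgda_oracle_calls_def)
qed

theorem theorem4p10:
  fixes f :: "(real ^ 'm) \<times> (real ^ 'n) \<Rightarrow> real"
    and Y :: "(real ^ 'n) set"
    and G :: "(real ^ 'm) \<times> (real ^ 'n) \<Rightarrow> 's \<Rightarrow> (real ^ 'm) \<times> (real ^ 'n)"
    and P :: "'s measure"
    and W :: "'w measure"
    and \<xi> :: "nat \<Rightarrow> nat \<Rightarrow> 'w \<Rightarrow> 's"
    and x0 :: "real ^ 'm" and y0 :: "real ^ 'n"
    and l L D \<sigma> \<epsilon> \<eta>x \<eta>y \<kappa> :: real
  defines "\<Phi> \<equiv> max_fun f Y"
  defines "env \<equiv> moreau_envelope (1 / (2 * l)) \<Phi>"
  defines "\<Delta>\<Phi> \<equiv> env x0 - (INF x. env x)"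
  defines "\<Delta>0 \<equiv> \<Phi> x0 - f (x0, y0)"
  defines "bound \<equiv>
      (l ^ 3 * (L\<^sup>2 + \<sigma>\<^sup>2) * D\<^sup>2 * \<Delta>\<Phi> / \<epsilon> ^ 6 + l ^ 3 * D\<^sup>2 * \<Delta>0 / \<epsilon> ^ 4) * max 1 (\<sigma>\<^sup>2 / \<epsilon>\<^sup>2)"
  assumes "0 < l" and "smooth_fun l f"
    and "\<And>y. y \<in> Y \<Longrightarrow> L-lipschitz_on UNIV (\<lambda>x. f (x, y))"
    and "\<And>x. concave_on UNIV (\<lambda>y. f (x, y))"
    and "Y \<noteq> {}" and "closed Y" and "convex Y" and "bounded Y" and "D = diameter Y"
    and "bdd_below (range \<Phi>)"
    and "0 \<le> \<sigma>" and "stochastic_gradient_oracle f P G \<sigma>"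
    and "iid_samples W P 1 \<xi>"
    and "y0 \<in> Y"
    and "0 < \<epsilon>" and "1 \<le> \<kappa>" and "\<epsilon> \<le> \<kappa> * \<sigma>" and "\<epsilon> \<le> \<kappa> * (l * D)"
    and "theta_with (eta_x_lo \<kappa>) (eta_x_hi \<kappa>) (\<epsilon> ^ 4 / (l ^ 3 * D\<^sup>2 * (L\<^sup>2 + \<sigma>\<^sup>2))) \<eta>x"
    and "theta_with (eta_y_lo \<kappa>) (eta_y_hi \<kappa>) (\<epsilon>\<^sup>2 / (l * \<sigma>\<^sup>2)) \<eta>y"
  shows "\<exists>T0 \<ge> 1.
      real T0 \<le> max 1 (complexity_const \<kappa> * bound) \<and>
      real (sgda_oracle_calls 1 T0) \<le> max 1 (complexity_const \<kappa> * bound) \<and>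
      (\<forall>T \<ge> T0. random_output_stationary W
         (\<lambda>t \<omega>. fst (sgda G Y \<eta>x \<eta>y 1 x0 y0 \<xi> t \<omega>)) T \<Phi> l \<epsilon>)"
proof -
  have D0: "0 \<le> D" using \<open>D = diameter Y\<close> diameter_ge_0[OF \<open>bounded Y\<close>] by simp
  note step_sizes = step_size_bounds[OF \<open>0 < l\<close> \<open>0 < \<epsilon>\<close> \<open>1 \<le> \<kappa>\<close> \<open>0 \<le> \<sigma>\<close> D0 \<open>\<epsilon> \<le> \<kappa> * \<sigma>\<close> \<open>\<epsilon> \<le> \<kappa> * (l * D)\<close>
      \<open>theta_with (eta_x_lo \<kappa>) (eta_x_hi \<kappa>) _ \<eta>x\<close> \<open>theta_with (eta_y_lo \<kappa>) (eta_y_hi \<kappa>) _ \<eta>y\<close>]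
  have pos: "0 < \<sigma>" "0 < D"
    using D0 \<open>0 \<le> \<sigma>\<close> \<open>0 < \<epsilon>\<close> \<open>\<epsilon> \<le> \<kappa> * \<sigma>\<close> \<open>\<epsilon> \<le> \<kappa> * (l * D)\<close> by (auto simp: order_le_less)
  interpret nonconvex_concave f Y l L D
    using \<open>0 < l\<close> \<open>smooth_fun l f\<close> \<open>\<And>y. y \<in> Y \<Longrightarrow> L-lipschitz_on UNIV (\<lambda>x. f (x, y))\<close>
      \<open>\<And>x. concave_on UNIV (\<lambda>y. f (x, y))\<close> \<open>Y \<noteq> {}\<close> \<open>closed Y\<close> \<open>convex Y\<close> \<open>bounded Y\<close>
      \<open>D = diameter Y\<close> diameter_bounded_bound[OF \<open>bounded Y\<close>]
    by unfold_locales (auto simp: dist_norm)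
  have \<Phi>_eq: "\<Phi> = max_plus (\<lambda>_. 0)" unfolding \<Phi>_def by (rule max_fun_eq)
  have env_eq: "env = env_plus (\<lambda>_. 0)" unfolding env_def \<Phi>_eq ..
  have bdd: "bdd_below (range (env_plus (\<lambda>_. 0)))"
  proof -
    obtain c where c: "\<And>w. c \<le> \<Phi> w" using \<open>bdd_below (range \<Phi>)\<close> unfolding bdd_below_def by auto
    have "c \<le> env_plus (\<lambda>_. 0) x" for x
    proof -
      obtain m where m: "is_prox (\<lambda>_. 0) x m" using is_prox_exists[of "\<lambda>_. 0"] by auto
      have "0 \<le> l * (norm (m - x))\<^sup>2" using \<open>0 < l\<close> by simp
      then show ?thesis using env_plus_eq[OF m] c[of m] unfolding \<Phi>_eq by linarith
    qed
    then show ?thesis by (intro bdd_belowI2)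
  qed
  interpret sgda_run f Y l L D P G W \<xi> \<sigma> \<eta>x \<eta>y "\<eta>x / \<eta>y" x0 y0
    using \<open>stochastic_gradient_oracle f P G \<sigma>\<close> \<open>iid_samples W P 1 \<xi>\<close> \<open>y0 \<in> Y\<close> step_sizes(1,2,3) bdd
    by unfold_locales auto
  let ?C = "complexity_const \<kappa>"
  have \<Delta>0: "0 \<le> \<Delta>0" unfolding \<Delta>0_def \<Phi>_eq using max_plus_ge[of "\<lambda>_. 0" y0 x0] \<open>y0 \<in> Y\<close> by simp
  have \<Delta>\<Phi>: "0 \<le> \<Delta>\<Phi>" unfolding \<Delta>\<Phi>_def env_eq using cINF_lower[OF bdd, of x0] by simp
  let ?A = "l ^ 3 * (L\<^sup>2 + \<sigma>\<^sup>2) * D\<^sup>2 * \<Delta>\<Phi> / \<epsilon> ^ 6"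
  have A: "0 \<le> ?A" using \<open>0 < l\<close> \<Delta>\<Phi> \<open>0 < \<epsilon>\<close> by simp
  have A_le: "?A \<le> bound"
  proof -
    have "?A * 1 \<le> (?A + l ^ 3 * D\<^sup>2 * \<Delta>0 / \<epsilon> ^ 4) * max 1 (\<sigma>\<^sup>2 / \<epsilon>\<^sup>2)"
      using A \<open>0 < l\<close> \<Delta>0 \<open>0 < \<epsilon>\<close> by (intro mult_mono) auto
    then show ?thesis unfolding bound_def by simp
  qed
  have C: "0 \<le> ?C" using \<open>1 \<le> \<kappa>\<close> by (simp add: complexity_const_def)
  define T0 where "T0 = max 1 (nat \<lfloor>?C * bound\<rfloor>)"
  have T0_le: "real T0 \<le> max 1 (?C * bound)"
    using C A A_le unfolding T0_def by (auto simp: max_def of_nat_floor)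
  have "random_output_stationary W (\<lambda>t \<omega>. fst (sgda G Y \<eta>x \<eta>y 1 x0 y0 \<xi> t \<omega>)) T \<Phi> l \<epsilon>" if T: "T0 \<le> T" for T
  proof (rule random_output_stationaryI[OF W.prob_space_axioms])
    show T1: "1 \<le> T" using T unfolding T0_def by simp
    have "?C * bound - 1 < real T"
    proof -
      have "\<lfloor>?C * bound\<rfloor> \<le> int T" using T unfolding T0_def by linarith
      then show ?thesis by linarith
    qed
    \<comment> \<open>Rounding down in \<open>T0\<close> loses less than 1 <= T, which costs the
      factor 2.\<close>
    then have "?C * bound \<le> 2 * real T" using T1 by linarith
    then have T2: "10 ^ 24 * \<kappa> ^ 4 * ?A \<le> 2 * real T"
      using mult_left_mono[OF A_le C] unfolding complexity_const_def by linarith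
    show "(\<lambda>\<omega>. grad (moreau_envelope (1 / (2 * l)) \<Phi>) (fst (sgda G Y \<eta>x \<eta>y 1 x0 y0 \<xi> j \<omega>))) \<in> borel_measurable W" for j
      using measurable_grad_env_Z[of j] unfolding \<Phi>_eq run_def .
    show "(\<Sum>j = 1..T. \<integral>\<^sup>+\<omega>. ennreal ((norm (grad (moreau_envelope (1 / (2 * l)) \<Phi>)
        (fst (sgda G Y \<eta>x \<eta>y 1 x0 y0 \<xi> j \<omega>))))\<^sup>2) \<partial>W) \<le> ennreal (real T * \<epsilon>\<^sup>2)"
      using mean_grad_sum_le_sq[OF refl \<open>0 < \<epsilon>\<close> \<open>1 \<le> \<kappa>\<close> pos(2,1) T1 T2[unfolded \<Delta>\<Phi>_def env_eq] step_sizes(4-9)]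
      unfolding mean_grad_def run_def \<Phi>_eq .
  qed
  moreover have "1 \<le> T0" unfolding T0_def by simp
  ultimately show ?thesis using T0_le unfolding sgda_oracle_calls_one by blast
qed

end
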